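(* Let $G$ be a 2-connected graph, $H$ a graph that is not a circuit, and $f:G\rightarrow H$ a circuit surjection. Then there exist graphs $G_1,G_2$ and maps $k:E(G)\to E(G_1)$, $h:E(G_1)\to E(G_2)$, $q:E(G_2)\to E(H)$ with $f=q\circ h\circ k$, such that: (i) $k$ is a bijection which preserves circuits in both directions, i.e. for $C\subseteq E(G)$, $C$ is a circuit of $G$ if and only if $k(C)$ is a circuit of $G_1$; (ii) $h$ is an onto edge map obtained by replacing suspended chains of $G_1$ by single edges (i.e. $G_2$ arises from $G_1$ by replacing each member of a family of pairwise edge-disjoint suspended chains by a single edge joining its two endpoints, $h$ sends every edge of such a chain to the corresponding new edge and fixes all other edges), and $h$ preserves circuits in both directions (the images under $h$ of circuits of $G_1$ are exactly the circuits of $G_2$); (iii) $q$ is a circuit injection.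
   Context: Graphs are undirected, without loops or multiple edges, and not necessarily finite. A circuit surjection $f:G\rightarrow H$ is a map from $E(G)$ onto $E(H)$ such that for every circuit $C$ of $G$, $f(C)$ is a circuit of $H$; $H$ is required to have no isolated vertices. A circuit injection is a circuit surjection that is one-to-one. "$H$ is not a circuit" means $H$ is not itself a single cycle. A suspended chain of a graph $G_1$ is a subgraph $P$ with a finite vertex set $V(P)$, $|V(P)|\geq 3$, having two distinct vertices $v_1,v_2$ (its endpoints) with $\deg_P v_1=\deg_P v_2=1$ and $\deg_P v=\deg_{G_1} v=2$ for all other $v\in V(P)$ (so $P$ is a path whose interior vertices have degree 2 in $G_1$). *)

theory Defs
  imports Main
begin

type_synonym 'v graph = "'v set \<times> 'v set set"

definition verts :: "'v graph \<Rightarrow> 'v set" where "verts G = fst G"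
definition edges :: "'v graph \<Rightarrow> 'v set set" where "edges G = snd G"

definition wf_graph :: "'v graph \<Rightarrow> bool" where
  "wf_graph G \<longleftrightarrow> (\<forall>e\<in>edges G. \<exists>u v. u \<noteq> v \<and> u \<in> verts G \<and> v \<in> verts G \<and> e = {u, v})"

definition no_isolated :: "'v graph \<Rightarrow> bool" where
  "no_isolated G \<longleftrightarrow> verts G = \<Union>(edges G)"

text \<open>Degree of a vertex in an edge set (infinite degree gives 0, never 1 or 2).\<close>
definition deg :: "'v set set \<Rightarrow> 'v \<Rightarrow> nat" where
  "deg E v = card {e\<in>E. v \<in> e}"

definition edge_connected :: "'v set set \<Rightarrow> bool" where
  "edge_connected C \<longleftrightarrow>
     (\<forall>D. D \<subseteq> C \<and> D \<noteq> {} \<and> D \<noteq> C \<longrightarrow> \<Union>D \<inter> \<Union>(C - D) \<noteq> {})"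

definition circuit :: "'v graph \<Rightarrow> 'v set set \<Rightarrow> bool" where
  "circuit G C \<longleftrightarrow> C \<subseteq> edges G \<and> finite C \<and> C \<noteq> {} \<and>
     (\<forall>v\<in>\<Union>C. deg C v = 2) \<and> edge_connected C"

definition connected_on :: "'v graph \<Rightarrow> 'v set \<Rightarrow> bool" where
  "connected_on G W \<longleftrightarrow>
     (\<forall>u\<in>W. \<forall>v\<in>W. (\<lambda>a b. {a, b} \<in> edges G \<and> a \<in> W \<and> b \<in> W)\<^sup>*\<^sup>* u v)"

definition two_connected :: "'v graph \<Rightarrow> bool" where
  "two_connected G \<longleftrightarrow> (infinite (verts G) \<or> card (verts G) \<ge> 3) \<and>
     connected_on G (verts G) \<and> (\<forall>x\<in>verts G. connected_on G (verts G - {x}))"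

definition circuit_surj :: "'v graph \<Rightarrow> 'w graph \<Rightarrow> ('v set \<Rightarrow> 'w set) \<Rightarrow> bool" where
  "circuit_surj G H f \<longleftrightarrow> no_isolated H \<and> f ` edges G = edges H \<and>
     (\<forall>C. circuit G C \<longrightarrow> circuit H (f ` C))"

definition circuit_inj :: "'v graph \<Rightarrow> 'w graph \<Rightarrow> ('v set \<Rightarrow> 'w set) \<Rightarrow> bool" where
  "circuit_inj G H f \<longleftrightarrow> circuit_surj G H f \<and> inj_on f (edges G)"

definition chain_ends :: "'v set set \<Rightarrow> 'v set" where
  "chain_ends P = {v\<in>\<Union>P. deg P v = 1}"

definition chain_interior :: "'v set set \<Rightarrow> 'v set" where
  "chain_interior P = \<Union>P - chain_ends P"

definition suspended_chain :: "'v graph \<Rightarrow> 'v set set \<Rightarrow> bool" where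
  "suspended_chain G P \<longleftrightarrow> P \<subseteq> edges G \<and> finite (\<Union>P) \<and> card (\<Union>P) \<ge> 3 \<and>
     edge_connected P \<and>
     (\<exists>v1 v2. v1 \<noteq> v2 \<and> v1 \<in> \<Union>P \<and> v2 \<in> \<Union>P \<and> deg P v1 = 1 \<and> deg P v2 = 1 \<and>
        (\<forall>v\<in>\<Union>P - {v1, v2}. deg P v = 2 \<and> deg (edges G) v = 2))"

text \<open>G2 arises from G1 by replacing each chain of the family Ps (pairwise edge-disjoint
suspended chains) by a single new edge joining its endpoints; h sends the chain edges
to the new edge and fixes all other edges.  Since graphs are simple, the new edges
must be distinct from each other and from the remaining edges.\<close>
definition chain_contraction :: "'v graph \<Rightarrow> 'v graph \<Rightarrow> ('v set \<Rightarrow> 'v set) \<Rightarrow> bool" where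
  "chain_contraction G1 G2 h \<longleftrightarrow>
     (\<exists>Ps. (\<forall>P\<in>Ps. suspended_chain G1 P) \<and>
        (\<forall>P\<in>Ps. \<forall>Q\<in>Ps. P \<noteq> Q \<longrightarrow> P \<inter> Q = {}) \<and>
        inj_on chain_ends Ps \<and>
        chain_ends ` Ps \<inter> (edges G1 - \<Union>Ps) = {} \<and>
        verts G2 = verts G1 - (\<Union>P\<in>Ps. chain_interior P) \<and>
        edges G2 = (edges G1 - \<Union>Ps) \<union> chain_ends ` Ps \<and>
        (\<forall>P\<in>Ps. \<forall>e\<in>P. h e = chain_ends P) \<and>
        (\<forall>e\<in>edges G1 - \<Union>Ps. h e = e))"

end

theory Submission
  imports Defs
begin

text \<open>
  Circuits are the minimal nonempty elements of the binary cycle space (finite edge sets with all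
  degrees even), so everything can be done with symmetric differences.

  Suppose \<open>f e = f e'\<close> but some circuit \<open>C\<close> contains \<open>e\<close> and not \<open>e'\<close>. Adding to \<open>C\<close> an ear
  through \<open>e'\<close> gives a theta whose three circuits all have the same image \<open>D = f C\<close>. If an edge \<open>g\<close>
  had \<open>f g \<notin> D\<close>, an ear of the theta through \<open>g\<close> would lie in three circuits that pairwise differ
  by circuits of the theta; their images are then pairwise complementary on \<open>D\<close>, which is absurd.
  So \<open>H\<close> is the circuit \<open>D\<close>. Hence, when \<open>H\<close> is not a circuit, every circuit is a union of
  fibres of \<open>f\<close>.

  Keep one representative of each fibre and contract the forest \<open>F\<close> of all other edges; the result
  is \<open>G2\<close>, on which \<open>f\<close> becomes injective. Rooting each tree of \<open>F\<close> makes room for subdividing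
  again inside the same vertex type: the roots are the vertices of \<open>G2\<close>, and each edge of \<open>F\<close> is
  represented by its endpoint away from the root. Subdividing the representative of every fibre by
  the vertices belonging to its remaining members yields \<open>G1\<close>.
\<close>

section \<open>Binary cycle spaces\<close>

text \<open>For a cycle space \<open>Z\<close> these are the circuits of the binary matroid with
  cycle space \<open>Z\<close>.\<close>

definition minimal_in :: "'e set set \<Rightarrow> 'e set \<Rightarrow> bool" where
  "minimal_in Z C \<longleftrightarrow> C \<in> Z \<and> C \<noteq> {} \<and> (\<forall>D\<in>Z. D \<subseteq> C \<longrightarrow> D = {} \<or> D = C)"

lemma minimal_inD:
  assumes "minimal_in Z C"
  shows "C \<in> Z" "C \<noteq> {}" "D \<in> Z \<Longrightarrow> D \<subseteq> C \<Longrightarrow> D = {} \<or> D = C"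
  using assms by (auto simp: minimal_in_def)

text \<open>A point of \<open>d\<close> would distinguish any two of the three sets, but membership
  has only two values.\<close>

lemma sym_diff_triangle:
  assumes "sym_diff a b = d" "sym_diff a c = d" "sym_diff b c = d"
  shows "d = {}"
proof (rule equals0I)
  fix x assume "x \<in> d"
  then have "x \<in> sym_diff a b" "x \<in> sym_diff a c" "x \<in> sym_diff b c" by (simp_all only: assms)
  then show False by auto
qed

text \<open>Take an inclusion-minimal member through \<open>e\<close>. A smaller member avoiding
  \<open>e\<close> could be subtracted, leaving a smaller member through \<open>e\<close>. The
  family is arbitrary because the argument is also needed for traces \<open>X - T\<close> of
  cycles.\<close>

lemma minimal_family_member:
  assumes W: "W0 \<in> \<W>" "finite W0" "e \<in> W0"
    and diff: "\<And>W W'. W \<in> \<W> \<Longrightarrow> W' \<in> \<W> \<Longrightarrow> W' \<subseteq> W \<Longrightarrow> W - W' \<in> \<W>"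
  obtains W where "W \<in> \<W>" "e \<in> W" "W \<subseteq> W0"
    "\<And>W'. W' \<in> \<W> \<Longrightarrow> W' \<subseteq> W \<Longrightarrow> W' = {} \<or> W' = W"
proof -
  define \<S> where "\<S> = {W \<in> \<W>. e \<in> W \<and> W \<subseteq> W0}"
  have "finite \<S>" unfolding \<S>_def using W(2) by (auto intro: finite_subset[of _ "Pow W0"])
  moreover have "W0 \<in> \<S>" using W unfolding \<S>_def by auto
  ultimately obtain W where W1: "W \<in> \<S>" and m: "\<forall>W'\<in>\<S>. W' \<subseteq> W \<longrightarrow> W = W'"
    using finite_has_minimal2[of \<S> W0] by blast
  have "W' = {} \<or> W' = W" if "W' \<in> \<W>" "W' \<subseteq> W" for W'
  proof (cases "e \<in> W'")
    case True
    then have "W' \<in> \<S>" using that W1 unfolding \<S>_def by auto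
    then show ?thesis using m that by auto
  next
    case False
    then have "W - W' \<in> \<S>" using diff[of W W'] that W1 unfolding \<S>_def by auto
    then have "W = W - W'" using m by blast
    then show ?thesis using that by blast
  qed
  then show ?thesis using that W1 unfolding \<S>_def by auto
qed

section \<open>Circuits, ears and thetas in a binary cycle space\<close>

locale cycle_space =
  fixes Z :: "'e set set"
  assumes finite_mem: "A \<in> Z \<Longrightarrow> finite A"
    and empty_mem: "{} \<in> Z"
    and sym_diff_mem: "A \<in> Z \<Longrightarrow> B \<in> Z \<Longrightarrow> sym_diff A B \<in> Z"
begin

lemma diff_mem: "A \<in> Z \<Longrightarrow> B \<in> Z \<Longrightarrow> B \<subseteq> A \<Longrightarrow> A - B \<in> Z"
  using sym_diff_mem[of A B] by (simp add: Diff_eq_empty_iff[THEN iffD2])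

lemma minimal_through:
  assumes "A \<in> Z" "e \<in> A"
  obtains C where "minimal_in Z C" "e \<in> C" "C \<subseteq> A"
proof -
  obtain W where "W \<in> Z" "e \<in> W" "W \<subseteq> A" "\<And>W'. W' \<in> Z \<Longrightarrow> W' \<subseteq> W \<Longrightarrow> W' = {} \<or> W' = W"
    using minimal_family_member[of A Z e] assms diff_mem finite_mem by metis
  then show ?thesis using that[of W] by (auto simp: minimal_in_def)
qed

text \<open>An ear of \<open>T\<close> is a circuit of the contraction by \<open>T\<close>; the condition \<open>Q \<notin> Z\<close> says that it is
  really attached to \<open>T\<close>.\<close>
definition ear :: "'e set \<Rightarrow> 'e set \<Rightarrow> bool" where
  "ear T Q \<longleftrightarrow> Q \<noteq> {} \<and> Q \<notin> Z \<and> Q \<inter> T = {} \<and> (\<exists>S\<in>Z. S - T = Q) \<and>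
     (\<forall>X\<in>Z. X \<subseteq> T \<union> Q \<longrightarrow> X \<inter> Q = {} \<or> Q \<subseteq> X)"

text \<open>Ears are minimal traces \<open>X - T\<close> of cycles, and the trace
  \<open>C - T\<close> contains \<open>g\<close>.\<close>

lemma ear_exists:
  assumes C: "minimal_in Z C" and g: "g \<in> C" "g \<notin> T" and CT: "C \<inter> T \<noteq> {}"
  obtains Q where "ear T Q" "g \<in> Q"
proof -
  let ?W = "(\<lambda>X. X - T) ` Z"
  have d: "W - W' \<in> ?W" if W: "W \<in> ?W" "W' \<in> ?W" "W' \<subseteq> W" for W W'
  proof -
    obtain X X' where X: "X \<in> Z" "X' \<in> Z" "W = X - T" "W' = X' - T" using W by auto
    \<comment> \<open>Traces are additive, and for nested traces the symmetric difference is the set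
      difference.\<close>
    then have "sym_diff X X' - T = W - W'" using W(3) by auto
    then show ?thesis using sym_diff_mem[OF X(1,2)] by (metis imageI)
  qed
  have CZ: "C \<in> Z" using C by (rule minimal_inD)
  obtain Q where Q: "Q \<in> ?W" "g \<in> Q" "Q \<subseteq> C - T"
     "\<And>W'. W' \<in> ?W \<Longrightarrow> W' \<subseteq> Q \<Longrightarrow> W' = {} \<or> W' = Q"
    using minimal_family_member[of "C - T" ?W g] d CZ finite_mem[OF CZ] g by (auto simp: image_iff)
  \<comment> \<open>\<open>Q\<close> misses the nonempty set \<open>C \<inter> T\<close>, so it is a
    proper part of the circuit \<open>C\<close>.\<close>
  have "Q \<notin> Z" using minimal_inD(3)[OF C, of Q] Q CT by auto
  moreover have "X \<inter> Q = {} \<or> Q \<subseteq> X" if "X \<in> Z" "X \<subseteq> T \<union> Q" for X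
    using Q(4)[of "X - T"] that Q(3) by auto
  ultimately have "ear T Q" unfolding ear_def using Q by auto
  then show ?thesis using that Q by auto
qed

text \<open>Three paths with common ends, described only by their edge sets; the last conjunct
  excludes any cycle besides the three circuits that they form in pairs.\<close>

definition theta :: "'e set \<Rightarrow> 'e set \<Rightarrow> 'e set \<Rightarrow> bool" where
  "theta A B P \<longleftrightarrow> A \<noteq> {} \<and> B \<noteq> {} \<and> P \<noteq> {} \<and> A \<inter> B = {} \<and> A \<inter> P = {} \<and> B \<inter> P = {} \<and>
     A \<union> B \<in> Z \<and> A \<union> P \<in> Z \<and> B \<union> P \<in> Z \<and>
     (\<forall>X\<in>Z. X \<subseteq> A \<union> B \<union> P \<longrightarrow> X = {} \<or> X = A \<union> B \<or> X = A \<union> P \<or> X = B \<union> P)"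

lemma theta_swap:
  assumes "theta A B P" shows "theta B A P" "theta A P B"
proof -
  have eq: "B \<union> A = A \<union> B" "P \<union> B = B \<union> P" "A \<union> P \<union> B = A \<union> B \<union> P"
    "B \<inter> A = A \<inter> B" "P \<inter> B = B \<inter> P" by blast+
  show "theta B A P" using assms unfolding theta_def eq by metis
  show "theta A P B" using assms unfolding theta_def eq by metis
qed

lemma theta_cases:
  assumes "theta A B P" "X \<in> Z" "X \<subseteq> A \<union> B \<union> P"
  shows "X = {} \<or> X = A \<union> B \<or> X = A \<union> P \<or> X = B \<union> P"
  using assms unfolding theta_def by metis

lemma theta_minimal:
  assumes "theta A B P" shows "minimal_in Z (A \<union> B)"
proof -
  obtain p where p: "p \<in> P" "p \<notin> A \<union> B" using assms unfolding theta_def by (metis Un_iff disjoint_iff all_not_in_conv)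
  have "D = {} \<or> D = A \<union> B" if "D \<in> Z" "D \<subseteq> A \<union> B" for D
  proof -
    have "D \<subseteq> A \<union> B \<union> P" using that by auto
    note theta_cases[OF assms that(1) this]
    moreover have "p \<notin> D" using p that by auto
    ultimately show ?thesis using p(1) by auto
  qed
  then show ?thesis using assms unfolding minimal_in_def theta_def by simp
qed

text \<open>Attach to \<open>C\<close> an ear \<open>Q\<close> through \<open>h\<close>. A cycle
  \<open>S\<close> with trace \<open>Q\<close> splits \<open>C\<close> into
  \<open>S \<inter> C\<close> and \<open>C - S\<close>. The two sides play symmetric roles, so the
  one containing \<open>e\<close> may be called \<open>A\<close>.\<close>

lemma theta_exists:
  assumes C: "minimal_in Z C" and C': "minimal_in Z C'" "h \<in> C'" "h \<notin> C" "e \<in> C" "C \<inter> C' \<noteq> {}"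
  obtains A B P where "theta A B P" "C = A \<union> B" "e \<in> A" "h \<in> P"
proof -
  obtain Q where Q: "ear C Q" "h \<in> Q"
    using ear_exists[of C' h C] C' by (auto simp: Int_commute)
  obtain S where S: "S \<in> Z" "S - C = Q" using Q unfolding ear_def by auto
  have CZ: "C \<in> Z" using C by (rule minimal_inD)
  have Qn: "Q \<notin> Z" "Q \<inter> C = {}" and
    Qm: "\<And>X. X \<in> Z \<Longrightarrow> X \<subseteq> C \<union> Q \<Longrightarrow> X \<inter> Q = {} \<or> Q \<subseteq> X"
    using Q unfolding ear_def by auto
  let ?S' = "sym_diff S C"
  define A where "A = S \<inter> C"
  define B where "B = C - S"
  have S'Z: "?S' \<in> Z" using sym_diff_mem S CZ by blast
  have eqs: "S = A \<union> Q" "?S' = B \<union> Q" "C = A \<union> B" using S(2) unfolding A_def B_def by auto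
  \<comment> \<open>If either side were empty, \<open>S\<close> or \<open>?S'\<close> would be
    \<open>Q\<close> itself, which is not a cycle.\<close>
  have ne: "A \<noteq> {}" "B \<noteq> {}"
    using Qn S(1) S'Z eqs(1,2) by auto
  have X: "X = {} \<or> X = A \<union> B \<or> X = A \<union> Q \<or> X = B \<union> Q"
    if X: "X \<in> Z" "X \<subseteq> A \<union> B \<union> Q" for X
  proof (cases "X \<inter> Q = {}")
    case True
    then have "X \<subseteq> C" using X eqs by auto
    then show ?thesis using minimal_inD(3)[OF C X(1)] eqs by auto
  next
    case False
    then have QX: "Q \<subseteq> X" using Qm[of X] X eqs by auto
    \<comment> \<open>Two cycles of the theta that both contain \<open>Q\<close> differ by a cycle
      inside the circuit \<open>C\<close>.\<close>
    then have "sym_diff X S \<subseteq> C" using X eqs by auto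
    then have "sym_diff X S = {} \<or> sym_diff X S = C"
      using minimal_inD(3)[OF C] sym_diff_mem[OF X(1) S(1)] by auto
    then have "X = S \<or> X = ?S'" by blast
    then show ?thesis using eqs by auto
  qed
  have t: "theta A B Q" unfolding theta_def
    using ne X S(1) S'Z CZ Q(2) Qn eqs unfolding A_def B_def by auto
  show ?thesis
  proof (cases "e \<in> A")
    case True
    then show ?thesis using that[of A B Q] t eqs Q(2) by auto
  next
    case False
    then show ?thesis using that[of B A Q] theta_swap(1)[OF t] eqs Q(2) C'(4) by auto
  qed
qed

text \<open>If \<open>h\<close> is off \<open>C\<close>, the theta on \<open>C\<close> with
  \<open>h\<close> in its third path has a circuit \<open>A \<union> P\<close> through both
  edges.\<close>

lemma common_minimal_trans:
  assumes "minimal_in Z C" "e \<in> C" "g \<in> C" "minimal_in Z C'" "g \<in> C'" "h \<in> C'"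
  obtains D where "minimal_in Z D" "e \<in> D" "h \<in> D"
proof (cases "h \<in> C")
  case True
  then show ?thesis using that assms by auto
next
  case False
  obtain A B P where t: "theta A B P" "C = A \<union> B" "e \<in> A" "h \<in> P"
    using theta_exists[of C C' h e] assms False by blast
  have "minimal_in Z (A \<union> P)" using theta_minimal theta_swap t(1) by blast
  then show ?thesis using that[of "A \<union> P"] t by auto
qed

text \<open>A cycle inside \<open>X\<close> either misses the ear, and then lies in the theta, or
  contains the ear, and then its complement in \<open>X\<close> lies in the theta. The only theta
  cycle that fits into \<open>X\<close> is empty.\<close>

lemma theta_ear_minimal:
  assumes t: "theta A B P" and Q: "ear (A \<union> B \<union> P) Q"
    and X: "X \<in> Z" "X - (A \<union> B \<union> P) = Q"
    and n: "\<not> A \<union> B \<subseteq> X" "\<not> A \<union> P \<subseteq> X" "\<not> B \<union> P \<subseteq> X"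
  shows "minimal_in Z X"
proof -
  have tt: "D = {} \<or> D = A \<union> B \<or> D = A \<union> P \<or> D = B \<union> P" if "D \<in> Z" "D \<subseteq> A \<union> B \<union> P" for D
    using theta_cases[OF t that] .
  have "D = {} \<or> D = X" if D: "D \<in> Z" "D \<subseteq> X" for D
  proof (cases "D \<inter> Q = {}")
    case True
    then have "D \<subseteq> A \<union> B \<union> P" using X D by auto
    then show ?thesis using tt[of D] D n by blast
  next
    case False
    moreover have "D \<subseteq> A \<union> B \<union> P \<union> Q" using X D by auto
    ultimately have "Q \<subseteq> D" using Q D(1) unfolding ear_def by blast
    then have "X - D \<subseteq> A \<union> B \<union> P" using X by auto
    then have "X - D = {}" using tt[of "X - D"] diff_mem[OF X(1) D] n by blast
    then show ?thesis using D by auto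
  qed
  then show ?thesis using X Q unfolding minimal_in_def ear_def by auto
qed

text \<open>There are four elements of \<open>Z\<close> that meet the complement of the theta in \<open>Q\<close>. If one of them
  fails to be minimal, it contains a circuit of the theta, and then the other three are minimal.\<close>
lemma theta_ear_three:
  assumes t: "theta A B P" and Q: "ear (A \<union> B \<union> P) Q"
  shows "\<exists>X1 X2 X3. (\<forall>X\<in>{X1, X2, X3}. minimal_in Z X \<and> X - (A \<union> B \<union> P) = Q) \<and>
    sym_diff X1 X2 \<in> {A \<union> B, A \<union> P, B \<union> P} \<and> sym_diff X1 X3 \<in> {A \<union> B, A \<union> P, B \<union> P} \<and>
    sym_diff X2 X3 \<in> {A \<union> B, A \<union> P, B \<union> P}" (is ?thm)
proof -
  let ?T = "A \<union> B \<union> P"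
  obtain S where S: "S \<in> Z" "S - ?T = Q" using Q unfolding ear_def by auto
  have Qn: "Q \<notin> Z" "Q \<inter> ?T = {}" using Q unfolding ear_def by auto
  have tt: "A \<noteq> {}" "B \<noteq> {}" "P \<noteq> {}" "A \<inter> B = {}" "A \<inter> P = {}" "B \<inter> P = {}"
     "A \<union> B \<in> Z" "A \<union> P \<in> Z" "B \<union> P \<in> Z" using t unfolding theta_def by auto
  have wrap: ?thm if "minimal_in Z X1" "minimal_in Z X2" "minimal_in Z X3"
    "X1 - ?T = Q" "X2 - ?T = Q" "X3 - ?T = Q"
    "sym_diff X1 X2 \<in> {A \<union> B, A \<union> P, B \<union> P}" "sym_diff X1 X3 \<in> {A \<union> B, A \<union> P, B \<union> P}"
    "sym_diff X2 X3 \<in> {A \<union> B, A \<union> P, B \<union> P}" for X1 X2 X3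
    by (rule exI[of _ X1], rule exI[of _ X2], rule exI[of _ X3], intro conjI that) (use that(1-6) in simp)
  \<comment> \<open>Stated for a renaming \<open>A'\<close>, \<open>B'\<close>, \<open>P'\<close> of
    the three paths, so that one argument serves whichever circuit of the theta lies inside
    \<open>X\<close>.\<close>
  have bad: ?thm if X: "X \<in> Z" "X - ?T = Q" and b: "A' \<union> B' \<subseteq> X"
    and t': "theta A' B' P'" and T: "A' \<union> B' \<union> P' = ?T" and
    tri: "{A' \<union> B', A' \<union> P', B' \<union> P'} = {A \<union> B, A \<union> P, B \<union> P}" for X A' B' P'
  proof -
    have p: "A' \<noteq> {}" "B' \<noteq> {}" "P' \<noteq> {}" "A' \<inter> B' = {}" "A' \<inter> P' = {}" "B' \<inter> P' = {}"
     "A' \<union> B' \<in> Z" "A' \<union> P' \<in> Z" "B' \<union> P' \<in> Z" using t' unfolding theta_def by auto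
    have X': "X - (A' \<union> B' \<union> P') = Q" using X T by simp
    \<comment> \<open>Otherwise removing the circuit \<open>A' \<union> B'\<close> from
      \<open>X\<close> would leave \<open>Q\<close> as a cycle. So \<open>X\<close> also meets
      \<open>P'\<close>.\<close>
    have "X \<noteq> A' \<union> B' \<union> Q"
    proof
      assume "X = A' \<union> B' \<union> Q"
      then have "X - (A' \<union> B') = Q" using Qn(2) T by blast
      then show False using diff_mem[OF X(1) p(7)] b Qn(1) by auto
    qed
    then have XP: "X \<inter> P' \<noteq> {}" using X' b by blast
    have e': "ear (A' \<union> B' \<union> P') Q" using Q T by simp
    note m = theta_ear_minimal[OF t' e']
    let ?X1 = "sym_diff X (A' \<union> B')" and ?X2 = "sym_diff X (A' \<union> P')" and ?X3 = "sym_diff X (B' \<union> P')"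
    have XZ: "?X1 \<in> Z" "?X2 \<in> Z" "?X3 \<in> Z"
      using sym_diff_mem[OF X(1)] p(7-9) by auto
    have Xd: "?X1 - (A' \<union> B' \<union> P') = Q" "?X2 - (A' \<union> B' \<union> P') = Q" "?X3 - (A' \<union> B' \<union> P') = Q"
      using X' by blast+
    \<comment> \<open>\<open>?X1\<close> avoids \<open>A'\<close> and \<open>B'\<close>, while
      \<open>?X2\<close> avoids \<open>A'\<close> and \<open>?X3\<close> avoids \<open>B'\<close>.
      The last two also lack a part of \<open>P'\<close>, as \<open>X\<close> meets
      \<open>P'\<close>. Hence none of the three contains a theta circuit.\<close>
    have "minimal_in Z ?X1"
      by (rule m[OF XZ(1) Xd(1)]) (use b p(1-6) in blast)+
    moreover have "minimal_in Z ?X2"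
      by (rule m[OF XZ(2) Xd(2)]) (use b p(1-6) XP in blast)+
    moreover have "minimal_in Z ?X3"
      by (rule m[OF XZ(3) Xd(3)]) (use b p(1-6) XP in blast)+
    moreover have "?X1 - ?T = Q" "?X2 - ?T = Q" "?X3 - ?T = Q"
      using X' unfolding T[symmetric] by blast+
    moreover have "sym_diff ?X1 ?X2 = B' \<union> P'" "sym_diff ?X1 ?X3 = A' \<union> P'" "sym_diff ?X2 ?X3 = A' \<union> B'"
      using p(4-6) by blast+
    then have "sym_diff ?X1 ?X2 \<in> {A' \<union> B', A' \<union> P', B' \<union> P'}"
      "sym_diff ?X1 ?X3 \<in> {A' \<union> B', A' \<union> P', B' \<union> P'}"
      "sym_diff ?X2 ?X3 \<in> {A' \<union> B', A' \<union> P', B' \<union> P'}" by (simp_all only: insertI1 insertI2)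
    ultimately show ?thm unfolding tri by (rule wrap)
  qed
  have dich: "minimal_in Z X \<or> ?thm" if "X \<in> Z" "X - ?T = Q" for X
  proof -
    have "?thm" if b: "A \<union> B \<subseteq> X"
      by (rule bad[OF \<open>X \<in> Z\<close> \<open>X - ?T = Q\<close> b t refl refl])
    moreover have "?thm" if b: "A \<union> P \<subseteq> X"
      by (rule bad[OF \<open>X \<in> Z\<close> \<open>X - ?T = Q\<close> b theta_swap(2)[OF t]])
         (simp_all only: Un_ac insert_commute)
    moreover have "?thm" if b: "B \<union> P \<subseteq> X"
      by (rule bad[OF \<open>X \<in> Z\<close> \<open>X - ?T = Q\<close> b theta_swap(2)[OF theta_swap(1)[OF t]]])
         (simp_all only: Un_ac insert_commute)
    ultimately show ?thesis using theta_ear_minimal[OF t Q that] by satx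
  qed
  let ?S1 = "sym_diff S (A \<union> B)" and ?S2 = "sym_diff S (A \<union> P)"
  have Z12: "?S1 \<in> Z" "?S2 \<in> Z" using sym_diff_mem S tt by auto
  have d12: "?S1 - ?T = Q" "?S2 - ?T = Q" using S by blast+
  have "sym_diff S ?S1 = A \<union> B" "sym_diff S ?S2 = A \<union> P" "sym_diff ?S1 ?S2 = B \<union> P"
    using tt(4-6) by blast+
  then have sd: "sym_diff S ?S1 \<in> {A \<union> B, A \<union> P, B \<union> P}" "sym_diff S ?S2 \<in> {A \<union> B, A \<union> P, B \<union> P}"
    "sym_diff ?S1 ?S2 \<in> {A \<union> B, A \<union> P, B \<union> P}" by (simp_all only: insertI1 insertI2)
  \<comment> \<open>Three of the four candidates already differ pairwise by theta circuits; if one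
    of them is not minimal, \<open>dich\<close> gives the claim by way of
    \<open>bad\<close>.\<close>
  have "?thm" if "minimal_in Z S" "minimal_in Z ?S1" "minimal_in Z ?S2"
    by (rule wrap[OF that S(2) d12 sd])
  then show ?thm using dich[OF S] dich[OF Z12(1) d12(1)] dich[OF Z12(2) d12(2)] by satx
qed

end

section \<open>Maps that send circuits to circuits\<close>

text \<open>A circuit \<open>C\<close> containing only one of two edges with equal image lies in a
  theta all of whose circuits have the image of \<open>C\<close>. An edge mapped outside that image
  would give an ear whose three circuits contradict \<open>sym_diff_triangle\<close>.\<close>

lemma minimal_surjection_series:
  assumes "cycle_space Z" and "cycle_space Z'"
    and img: "\<And>C. minimal_in Z C \<Longrightarrow> minimal_in Z' (f ` C)"
    and conn: "\<And>e g. e \<in> E \<Longrightarrow> g \<in> E \<Longrightarrow> e \<noteq> g \<Longrightarrow> \<exists>C. minimal_in Z C \<and> e \<in> C \<and> g \<in> C"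
    and C: "minimal_in Z C" "C \<subseteq> E" and e: "e \<in> C" and e': "e' \<in> E" "e' \<notin> C" and fe: "f e = f e'"
  shows "f ` E = f ` C"
proof -
  interpret Z: cycle_space Z by fact
  interpret Z': cycle_space Z' by fact
  obtain C' where C': "minimal_in Z C'" "e \<in> C'" "e' \<in> C'" using conn[of e e'] e e' C by auto
  obtain A B P where t: "Z.theta A B P" and CA: "C = A \<union> B" and eA: "e \<in> A" "e' \<in> P"
    using Z.theta_exists[of C C' e' e] C C' e e' by blast
  let ?D = "f ` C"
  have D: "minimal_in Z' ?D" using img C by auto
  have m: "minimal_in Z' (f ` (A \<union> P))" "minimal_in Z' (f ` (B \<union> P))"
    using Z.theta_minimal Z.theta_swap t img by blast+
  \<comment> \<open>\<open>?Y\<close> is a cycle inside the circuit \<open>f\<close> of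
    \<open>A \<union> P\<close>, and it misses the point \<open>f e = f e'\<close> of that circuit,
    because \<open>e\<close> is in \<open>A\<close> and \<open>e'\<close> in \<open>P\<close>. So it
    is empty.\<close>
  let ?Y = "sym_diff (f ` (A \<union> B)) (f ` (B \<union> P))"
  have "?Y \<in> Z'" using Z'.sym_diff_mem minimal_inD(1) D m CA by metis
  moreover have "f e \<in> f ` (A \<union> B)" "f e \<in> f ` (B \<union> P)" "f e \<in> f ` (A \<union> P)"
    using eA by (auto, auto simp: fe)
  then have "f e \<notin> ?Y" "f e \<in> f ` (A \<union> P)" by blast+
  moreover have "?Y \<subseteq> f ` (A \<union> P)" by auto
  ultimately have "?Y = {}" using minimal_inD(3)[OF m(1)] by blast
  then have bp: "f ` (B \<union> P) = ?D" unfolding CA by blast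
  then have "f ` (A \<union> P) \<subseteq> ?D" unfolding CA by blast
  then have ap: "f ` (A \<union> P) = ?D" using minimal_inD[OF m(1)] minimal_inD[OF D] by metis
  have "f g \<in> ?D" if g: "g \<in> E" for g
  proof (rule ccontr)
    assume gD: "f g \<notin> ?D"
    let ?T = "A \<union> B \<union> P"
    have fT: "f ` ?T = ?D" using bp unfolding CA by blast
    have gT: "g \<notin> ?T" using gD fT by blast
    then have "e \<noteq> g" using eA by auto
    then obtain C'' where C'': "minimal_in Z C''" "e \<in> C''" "g \<in> C''" using conn[of e g] e g C by auto
    then obtain Q where Q: "Z.ear ?T Q" "g \<in> Q" using Z.ear_exists[of C'' g ?T] eA gT by blast
    obtain X1 X2 X3 where
      X: "\<forall>X\<in>{X1, X2, X3}. minimal_in Z X \<and> X - ?T = Q" and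
      d: "sym_diff X1 X2 \<in> {A \<union> B, A \<union> P, B \<union> P}" "sym_diff X1 X3 \<in> {A \<union> B, A \<union> P, B \<union> P}"
      "sym_diff X2 X3 \<in> {A \<union> B, A \<union> P, B \<union> P}"
      using Z.theta_ear_three[OF t Q(1)] by (elim exE conjE) (rule that)
    \<comment> \<open>The two images can differ only on the image of \<open>sym_diff X Y\<close>,
      which is the circuit \<open>?D\<close>, so they differ in nothing or in all of
      \<open>?D\<close>. If they were equal, the image of \<open>X\<close> would contain
      \<open>?D\<close> and hence equal it, although \<open>g\<close> lies in
      \<open>X\<close>.\<close>
    have key: "sym_diff (f ` X) (f ` Y) = ?D"
      if XY: "X \<in> {X1, X2, X3}" "Y \<in> {X1, X2, X3}" "sym_diff X Y \<in> {A \<union> B, A \<union> P, B \<union> P}" for X Y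
    proof -
      have mX: "minimal_in Z' (f ` X)" "minimal_in Z' (f ` Y)" using X XY img by blast+
      have eq: "X - ?T = Q" "Y - ?T = Q" using X XY by blast+
      have "sym_diff (f ` X) (f ` Y) \<subseteq> f ` (sym_diff X Y)" by blast
      also have fd: "f ` (sym_diff X Y) = ?D"
        using XY(3) by (elim insertE emptyE) (simp_all only: ap bp CA[symmetric])
      finally have "sym_diff (f ` X) (f ` Y) = {} \<or> ?thesis"
        using minimal_inD(3)[OF D] Z'.sym_diff_mem minimal_inD(1)[OF mX(1)] minimal_inD(1)[OF mX(2)] by blast
      moreover have "sym_diff (f ` X) (f ` Y) \<noteq> {}"
      proof
        assume "sym_diff (f ` X) (f ` Y) = {}"
        then have "?D \<subseteq> f ` X" unfolding fd[symmetric] by blast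
        then have "?D = f ` X" using minimal_inD[OF mX(1)] minimal_inD[OF D] by metis
        then show False using gD Q(2) eq by blast
      qed
      ultimately show ?thesis by blast
    qed
    have "sym_diff (f ` X1) (f ` X2) = ?D" "sym_diff (f ` X1) (f ` X3) = ?D" "sym_diff (f ` X2) (f ` X3) = ?D"
      using key d by auto
    then have "?D = {}" by (rule sym_diff_triangle)
    then show False using D by (auto simp: minimal_in_def)
  qed
  then show ?thesis using C(2) by auto
qed

section \<open>The cycle space of a graph\<close>

definition cycles :: "'v set set \<Rightarrow> 'v set set set" where
  "cycles E = {A. A \<subseteq> E \<and> finite A \<and> (\<forall>v. even (deg A v))}"

text \<open>For finite \<open>A\<close> this is the boundary of \<open>A\<close> over the
  two-element field.\<close>

definition odd_verts :: "'v set set \<Rightarrow> 'v set" where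
  "odd_verts A = {v. odd (deg A v)}"

lemma cycles_iff: "A \<in> cycles E \<longleftrightarrow> A \<subseteq> E \<and> finite A \<and> odd_verts A = {}"
  by (auto simp: cycles_def odd_verts_def)

lemma card_sym_diff_even:
  assumes "finite X" "finite Y"
  shows "even (card (sym_diff X Y)) \<longleftrightarrow> even (card X + card Y)"
proof -
  have "card (sym_diff X Y) = card (X - Y) + card (Y - X)"
    using assms by (intro card_Un_disjoint) auto
  moreover have "card X = card (X - Y) + card (X \<inter> Y)"
    using assms by (metis Int_commute card_Diff_subset_Int card_mono finite_Int inf_le1 le_add_diff_inverse2)
  moreover have "card Y = card (Y - X) + card (X \<inter> Y)"
    using assms by (metis Int_commute card_Diff_subset_Int card_mono finite_Int inf_le1 le_add_diff_inverse2)
  ultimately show ?thesis by presburger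
qed

lemma odd_verts_sym_diff:
  assumes "finite A" "finite B"
  shows "odd_verts (sym_diff A B) = sym_diff (odd_verts A) (odd_verts B)"
proof (rule set_eqI)
  fix v
  have "{e \<in> sym_diff A B. v \<in> e} = sym_diff {e \<in> A. v \<in> e} {e \<in> B. v \<in> e}" by auto
  then have "even (deg (sym_diff A B) v) \<longleftrightarrow> even (deg A v + deg B v)"
    unfolding deg_def using card_sym_diff_even[of "{e \<in> A. v \<in> e}" "{e \<in> B. v \<in> e}"] assms by simp
  then show "v \<in> odd_verts (sym_diff A B) \<longleftrightarrow> v \<in> sym_diff (odd_verts A) (odd_verts B)"
    unfolding odd_verts_def by auto
qed

lemma cycle_space_cycles: "cycle_space (cycles E)"
proof
  fix A B assume "A \<in> cycles E" "B \<in> cycles E"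
  then show "sym_diff A B \<in> cycles E"
    using odd_verts_sym_diff[of A B] by (auto simp: cycles_iff)
qed (auto simp: cycles_def deg_def)

lemma deg_insert:
  assumes "finite A" "e \<notin> A"
  shows "deg (insert e A) v = deg A v + (if v \<in> e then 1 else 0)"
proof -
  have "{f \<in> insert e A. v \<in> f} = (if v \<in> e then insert e {f \<in> A. v \<in> f} else {f \<in> A. v \<in> f})" by auto
  then show ?thesis unfolding deg_def using assms by simp
qed

lemma odd_verts_empty [simp]: "odd_verts {} = {}"
  by (simp add: odd_verts_def deg_def)

lemma odd_verts_insert:
  "finite A \<Longrightarrow> e \<notin> A \<Longrightarrow> odd_verts (insert e A) = sym_diff (odd_verts A) e"
  by (auto simp: odd_verts_def deg_insert)

lemma odd_verts_singleton [simp]: "odd_verts {e} = e"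
  using odd_verts_insert[of "{}" e] by simp

lemma odd_verts_Un_disjoint:
  "finite A \<Longrightarrow> finite B \<Longrightarrow> A \<inter> B = {} \<Longrightarrow> odd_verts (A \<union> B) = sym_diff (odd_verts A) (odd_verts B)"
  using odd_verts_sym_diff[of A B] by (simp add: Diff_triv Int_commute)

text \<open>A handshake argument: boundaries add up, and each edge contributes the parity of its
  number of ends in \<open>X\<close>. Applied to \<open>X\<close> a component, this counts the edges
  leaving it.\<close>

lemma odd_verts_parity:
  assumes "finite A" "\<forall>e\<in>A. finite e"
  shows "finite (odd_verts A) \<and>
    (even (card (odd_verts A \<inter> X)) \<longleftrightarrow> even (card {e \<in> A. odd (card (e \<inter> X))}))"
  using assms
proof (induction A rule: finite_induct)
  case (insert e A)
  then have fin: "finite (odd_verts A)" "finite e" by auto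
  have "odd_verts (insert e A) \<inter> X = sym_diff (odd_verts A \<inter> X) (e \<inter> X)"
    using odd_verts_insert[OF insert(1,2)] by auto
  then have "even (card (odd_verts (insert e A) \<inter> X)) \<longleftrightarrow> even (card (odd_verts A \<inter> X) + card (e \<inter> X))"
    using card_sym_diff_even[of "odd_verts A \<inter> X" "e \<inter> X"] fin by simp
  moreover have "{f \<in> insert e A. odd (card (f \<inter> X))} =
      (if odd (card (e \<inter> X)) then insert e {f \<in> A. odd (card (f \<inter> X))} else {f \<in> A. odd (card (f \<inter> X))})"
    by auto
  ultimately show ?case using insert odd_verts_insert[OF insert(1,2)] fin by auto
qed simp

section \<open>Paths and their boundaries\<close>

text \<open>\<open>arc u W J v\<close>: a path from \<open>u\<close> to \<open>v\<close> with vertex set \<open>W\<close> and edge set \<open>J\<close>.\<close>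
inductive arc :: "'v \<Rightarrow> 'v set \<Rightarrow> 'v set set \<Rightarrow> 'v \<Rightarrow> bool" for u where
  arc_refl: "arc u {u} {} u"
| arc_step: "arc u W J v \<Longrightarrow> w \<notin> W \<Longrightarrow> arc u (insert w W) (insert {v, w} J) w"

lemma arc_basic:
  assumes "arc u W J v"
  shows "finite W" "finite J" "u \<in> W" "v \<in> W" "W = insert u (\<Union>J)"
    "\<forall>e\<in>J. card e = 2" "u = v \<longleftrightarrow> J = {}"
  using assms
proof (induction rule: arc.induct)
  case (arc_step W J v w)
  have ne: "v \<noteq> w" "u \<noteq> w" using arc_step(2,5,6) by auto
  {
    case 1 show ?case using arc_step(3) by simp
  next
    case 2 show ?case using arc_step(4) by simp
  next
    case 3 show ?case using arc_step(5) by simp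
  next
    case 4 show ?case by simp
  next
    case 5 show ?case using arc_step(6,7) by blast
  next
    case 6 show ?case using arc_step(8) ne by simp
  next
    case 7 show ?case using ne by simp
  }
qed simp_all

lemma arc_deg:
  assumes "arc u W J v"
  shows "deg J x = (if J = {} then 0 else if x = u \<or> x = v then 1 else if x \<in> W then 2 else 0)"
  using assms
proof (induction rule: arc.induct)
  case arc_refl
  then show ?case by (simp add: deg_def)
next
  case (arc_step W J v w)
  note b = arc_basic[OF arc_step(1)]
  have ne: "w \<noteq> u" "w \<noteq> v" using b(3,4) arc_step(2) by auto
  have "{v, w} \<notin> J" using b(5) arc_step(2) by blast
  then have d: "deg (insert {v, w} J) x = deg J x + (if x \<in> {v, w} then 1 else 0)"
    using deg_insert[of J "{v, w}" x] b(2) by simp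
  show ?case
  proof (cases "J = {}")
    case True
    then have "u = v" "W = {u}" using b(5,7) by simp_all
    then show ?thesis using d True ne by (simp add: deg_def)
  next
    case False
    then have "u \<noteq> v" using b(7) by simp
    then show ?thesis using d ne arc_step(2,3) False b(3,4) by auto
  qed
qed

lemma arc_odd_verts:
  assumes "arc u W J v" shows "odd_verts J = sym_diff {u} {v}"
proof -
  have "u = v \<longleftrightarrow> J = {}" by (rule arc_basic(7)[OF assms])
  then show ?thesis using arc_deg[OF assms] unfolding odd_verts_def by auto
qed

text \<open>A proper part of the longer path either splits the shorter path properly, or separates
  the last edge from all of it; in the second case \<open>v\<close> is the common vertex.\<close>

lemma arc_edge_connected:
  assumes "arc u W J v"
  shows "edge_connected J"
  using assms
proof (induction rule: arc.induct)
  case arc_refl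
  then show ?case by (simp add: edge_connected_def)
next
  case (arc_step W J v w)
  show ?case unfolding edge_connected_def
  proof (intro allI impI, elim conjE)
    fix D assume D: "D \<subseteq> insert {v, w} J" "D \<noteq> {}" "D \<noteq> insert {v, w} J"
    have wJ: "{v, w} \<notin> J" using arc_basic(5)[OF arc_step(1)] arc_step(2) by blast
    have vJ: "v \<in> \<Union>J" if "J \<noteq> {}"
    proof -
      have "deg J v = 1" using arc_deg[OF arc_step(1), of v] that by simp
      then have "card {e \<in> J. v \<in> e} \<noteq> 0" unfolding deg_def by simp
      then have "{e \<in> J. v \<in> e} \<noteq> {}" by (metis card.empty)
      then show ?thesis by auto
    qed
    consider "D \<inter> J = {}" | "D \<inter> J = J" | "D \<inter> J \<noteq> {}" "D \<inter> J \<noteq> J" by auto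
    then show "\<Union>D \<inter> \<Union>(insert {v, w} J - D) \<noteq> {}"
    proof cases
      case 1
      then have "D = {{v, w}}" using D by blast
      moreover have "J \<noteq> {}" using D(3) calculation by auto
      ultimately show ?thesis using vJ wJ by auto
    next
      case 2
      then have "D = J" using D by blast
      then show ?thesis using vJ D(2) wJ by auto
    next
      case 3
      then have "\<Union>(D \<inter> J) \<inter> \<Union>(J - D \<inter> J) \<noteq> {}"
        using arc_step(3) unfolding edge_connected_def by auto
      then show ?thesis by blast
    qed
  qed
qed

lemma arc_suffix:
  assumes "arc u W J v" "w \<in> W"
  shows "\<exists>W' J'. arc w W' J' v \<and> J' \<subseteq> J"
  using assms
proof (induction rule: arc.induct)
  case arc_refl
  then have "arc w {u} {} u" using arc.arc_refl[of u] by simp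
  then show ?case by blast
next
  case (arc_step W J v z)
  show ?case
  proof (cases "w = z")
    case True
    then have "arc w {w} {} z" using arc.arc_refl[of w] by simp
    then show ?thesis by blast
  next
    case False
    then obtain W' J' where *: "arc w W' J' v" "J' \<subseteq> J" using arc_step(3,4) by blast
    have "W' \<subseteq> insert w W"
      using arc_basic(5)[OF *(1)] arc_basic(5)[OF arc_step(1)] *(2) by blast
    then have "z \<notin> W'" using False arc_step(2) by blast
    then have "arc w (insert z W') (insert {v, z} J') z" by (rule arc.arc_step[OF *(1)])
    moreover have "insert {v, z} J' \<subseteq> insert {v, z} J" using *(2) by blast
    ultimately show ?thesis by blast
  qed
qed

lemma arc_prefix:
  assumes "arc u W J v" "w \<in> W"
  shows "\<exists>W' J'. arc u W' J' w \<and> J' \<subseteq> J"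
  using assms
proof (induction rule: arc.induct)
  case arc_refl
  then have "arc u {u} {} w" using arc.arc_refl[of u] by simp
  then show ?case by blast
next
  case (arc_step W J v z)
  show ?case
  proof (cases "w = z")
    case True
    then have "arc u (insert z W) (insert {v, z} J) w" using arc.arc_step[OF arc_step(1,2)] by simp
    then show ?thesis by blast
  next
    case False
    then obtain W' J' where "arc u W' J' w" "J' \<subseteq> J" using arc_step(3,4) by blast
    then show ?thesis by blast
  qed
qed

text \<open>A walk is shortened to a path while it is read: on returning to a visited vertex, keep
  only the prefix up to that vertex.\<close>

lemma rtranclp_arc:
  assumes "R\<^sup>*\<^sup>* u v" "\<And>a b. R a b \<Longrightarrow> {a, b} \<in> E"
  shows "\<exists>W J. arc u W J v \<and> J \<subseteq> E"
  using assms(1)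
proof (induction rule: rtranclp_induct)
  case base
  show ?case by (intro exI conjI, rule arc_refl) simp
next
  case (step y z)
  then obtain W J where J: "arc u W J y" "J \<subseteq> E" by blast
  show ?case
  proof (cases "z \<in> W")
    case True
    from arc_prefix[OF J(1) this] obtain W' J' where "arc u W' J' z" "J' \<subseteq> J" by blast
    then show ?thesis using J(2) by blast
  next
    case False
    then have "arc u (insert z W) (insert {y, z} J) z" by (rule arc_step[OF J(1)])
    moreover have "insert {y, z} J \<subseteq> E" using assms(2)[OF step(2)] J(2) by blast
    ultimately show ?thesis by blast
  qed
qed

text \<open>Take a longest path in \<open>A\<close>. Its end \<open>v\<close> has even degree in
  \<open>A\<close> but degree 1 on the path, so a further edge leaves \<open>v\<close>; by
  maximality it returns to the path and closes a suffix to a circuit.\<close>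

lemma cycle_contains_2_regular:
  assumes A: "A \<in> cycles E" "A \<noteq> {}" and E: "\<forall>e\<in>E. card e = 2"
  shows "\<exists>C\<subseteq>A. C \<in> cycles E \<and> C \<noteq> {} \<and> (\<forall>v\<in>\<Union>C. deg C v = 2)"
proof -
  have fA: "finite A" and AE: "A \<subseteq> E" and evA: "\<And>v. even (deg A v)" using A by (auto simp: cycles_def)
  \<comment> \<open>The lengths of the nontrivial paths in \<open>A\<close>, bounded by the size of
    \<open>A\<close>.\<close>
  define K where "K = {card J | u W J v. arc u W J v \<and> J \<subseteq> A \<and> J \<noteq> {}}"
  obtain e where e: "e \<in> A" using A by auto
  have "card e = 2" using e AE E by blast
  then obtain a b where ab: "e = {a, b}" "a \<noteq> b" by (auto simp: card_2_iff)
  have "arc a {b, a} {e} b" using arc_step[OF arc_refl, of b a] ab by simp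
  then have "card {e} \<in> K" unfolding K_def using e by blast
  moreover have "K \<subseteq> {..card A}" unfolding K_def using fA by (auto intro: card_mono)
  ultimately have K: "finite K" "K \<noteq> {}" using finite_subset by auto
  obtain m where m: "m \<in> K" "\<forall>n\<in>K. n \<le> m" using Max_in[OF K] Max_ge[OF K(1)] by blast
  then obtain u W J v where J: "arc u W J v" "J \<subseteq> A" "J \<noteq> {}" "card J = m"
    unfolding K_def by auto
  have mx: "card J' \<le> card J" if "arc u' W' J' v'" "J' \<subseteq> A" "J' \<noteq> {}" for u' W' J' v'
    using m(2) J(4) that unfolding K_def by blast
  have finJ: "finite J" by (rule arc_basic(2)[OF J(1)])
  have "{e \<in> J. v \<in> e} \<noteq> {e \<in> A. v \<in> e}"
  proof
    assume "{e \<in> J. v \<in> e} = {e \<in> A. v \<in> e}"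
    then have "deg A v = deg J v" by (simp add: deg_def)
    then have "deg A v = 1" using arc_deg[OF J(1), of v] J(3) by simp
    then show False using evA[of v] by simp
  qed
  then obtain g where g: "g \<in> A" "g \<notin> J" "v \<in> g" using J(2) by auto
  have "card g = 2" using g(1) AE E by blast
  then obtain w where w: "g = {v, w}" "v \<noteq> w" using g(3) by (auto simp: card_2_iff)
  have "w \<in> W"
  proof (rule ccontr)
    assume "w \<notin> W"
    then have "arc u (insert w W) (insert g J) w" using arc_step[OF J(1)] w by simp
    then have "card (insert g J) \<le> card J" using mx g J(2) by blast
    then show False using finJ g by simp
  qed
  from arc_suffix[OF J(1) this]
  obtain W' J' where J': "arc w W' J' v" "J' \<subseteq> J" by blast
  note b = arc_basic[OF J'(1)]
  let ?C = "insert g J'"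
  have ne: "J' \<noteq> {}" using b(7) w(2) by auto
  have gJ': "g \<notin> J'" using g(2) J'(2) by blast
  have d: "deg ?C x = (if x \<in> W' then 2 else 0)" for x
    using deg_insert[OF b(2) gJ', of x] b(3,4) arc_deg[OF J'(1), of x] ne w by auto
  have "\<Union>?C \<subseteq> W'" using b(3-5) w(1) by blast
  then have "\<forall>v\<in>\<Union>?C. deg ?C v = 2" using d by auto
  moreover have "?C \<in> cycles E" unfolding cycles_def using d b(2) g J'(2) J(2) AE by auto
  moreover have "?C \<subseteq> A" using g J' J by auto
  ultimately show ?thesis by blast
qed

section \<open>Circuits as minimal cycles, and common circuits in 2-connected graphs\<close>

lemma wf_graph_iff: "wf_graph G \<longleftrightarrow> (\<forall>e\<in>edges G. card e = 2 \<and> e \<subseteq> verts G)"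
  unfolding wf_graph_def by (fastforce simp: card_2_iff)

text \<open>A proper nonempty subset of a connected 2-regular set has degree 1 at a vertex shared
  with its complement, so it is not a cycle. Conversely, a minimal cycle equals the 2-regular cycle
  inside it, and a part without contact to the rest would be a smaller cycle.\<close>

lemma circuit_iff_minimal:
  assumes "wf_graph G"
  shows "circuit G C \<longleftrightarrow> minimal_in (cycles (edges G)) C"
proof
  have E: "\<forall>e\<in>edges G. card e = 2" using assms wf_graph_iff by blast
  {
    assume C: "circuit G C"
    then have fC: "finite C" and d2: "\<And>v. v \<in> \<Union>C \<Longrightarrow> deg C v = 2" by (auto simp: circuit_def)
    have d0: "deg C v = 0" if "v \<notin> \<Union>C" for v
      using that unfolding deg_def by (auto simp: card_eq_0_iff)
    have "even (deg C v)" for v using d2[of v] d0[of v] by (cases "v \<in> \<Union>C") auto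
    then have CZ: "C \<in> cycles (edges G)" using C by (auto simp: cycles_def circuit_def)
    have "D = {} \<or> D = C" if D: "D \<in> cycles (edges G)" "D \<subseteq> C" for D
    proof (rule ccontr)
      assume n: "\<not> ?thesis"
      then have "\<Union>D \<inter> \<Union>(C - D) \<noteq> {}" using C D(2) unfolding circuit_def edge_connected_def by blast
      then obtain v where v: "v \<in> \<Union>D" "v \<in> \<Union>(C - D)" by blast
      let ?d = "{e \<in> D. v \<in> e}" and ?c = "{e \<in> C. v \<in> e}"
      have s: "?d \<subset> ?c" using v D(2) by auto
      have "card ?d < card ?c" using s fC by (intro psubset_card_mono) auto
      moreover have "card ?c = 2" using d2[of v] v D(2) unfolding deg_def by auto
      moreover have "even (card ?d)" using D unfolding cycles_def deg_def by auto
      moreover have "?d \<noteq> {}" "finite ?d" using v finite_subset[OF D(2) fC] by auto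
      then have "card ?d \<noteq> 0" by (simp add: card_eq_0_iff del: Collect_empty_eq)
      ultimately show False by presburger
    qed
    then show "minimal_in (cycles (edges G)) C" using CZ C unfolding minimal_in_def circuit_def by auto
  next
    assume C: "minimal_in (cycles (edges G)) C"
    note CZ = minimal_inD(1)[OF C] and Cn = minimal_inD(2)[OF C]
    obtain D where D: "D \<subseteq> C" "D \<in> cycles (edges G)" "D \<noteq> {}" "\<forall>v\<in>\<Union>D. deg D v = 2"
      using cycle_contains_2_regular[OF CZ Cn E] by blast
    then have "D = C" using minimal_inD(3)[OF C] by blast
    then have d2: "\<forall>v\<in>\<Union>C. deg C v = 2" using D(4) by simp
    have "edge_connected C" unfolding edge_connected_def
    proof (intro allI impI notI, elim conjE)
      fix D assume D: "D \<subseteq> C" "D \<noteq> {}" "D \<noteq> C" "\<Union>D \<inter> \<Union>(C - D) = {}"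
      have "even (deg D v)" for v
      proof (cases "v \<in> \<Union>D")
        case True
        then have "{e \<in> D. v \<in> e} = {e \<in> C. v \<in> e}" using D by blast
        then show ?thesis using CZ unfolding cycles_def deg_def by auto
      next
        case False
        then have "{e \<in> D. v \<in> e} = {}" by auto
        then show ?thesis unfolding deg_def by (simp only: card.empty even_zero)
      qed
      then have "D \<in> cycles (edges G)" using D(1) CZ finite_subset unfolding cycles_def by blast
      then show False using minimal_inD(3)[OF C] D by blast
    qed
    then show "circuit G C" unfolding circuit_def using CZ Cn d2 by (auto simp: cycles_def)
  }
qed

text \<open>Lying on a common circuit is transitive, so by connectedness it suffices to treat two
  edges at one vertex \<open>x\<close>. There, a path between their other ends that avoids
  \<open>x\<close> closes a cycle.\<close>

lemma two_connected_common_circuit: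
  assumes G: "wf_graph G" "two_connected G" and eg: "e \<in> edges G" "g \<in> edges G" "e \<noteq> g"
  shows "\<exists>C. minimal_in (cycles (edges G)) C \<and> e \<in> C \<and> g \<in> C"
proof -
  let ?Z = "cycles (edges G)"
  interpret cycle_space ?Z by (rule cycle_space_cycles)
  \<comment> \<open>Equality is included so that \<open>rel\<close> is reflexive, whether or not an
    edge lies on a circuit.\<close>
  define rel where "rel = (\<lambda>e g. e = g \<or> (\<exists>C. minimal_in ?Z C \<and> e \<in> C \<and> g \<in> C))"
  have trans: "rel a c" if "rel a b" "rel b c" for a b c
    using that common_minimal_trans unfolding rel_def by metis
  have adj: "rel {x, u} {x, v}" if uv: "{x, u} \<in> edges G" "{x, v} \<in> edges G" for x u v
  proof (cases "u = v")
    case False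
    have n: "x \<noteq> u" "x \<noteq> v" "x \<in> verts G" "u \<in> verts G" "v \<in> verts G"
      using uv G(1) unfolding wf_graph_iff by (fastforce simp: card_2_iff)+
    let ?R = "\<lambda>a b. {a, b} \<in> edges G \<and> a \<in> verts G - {x} \<and> b \<in> verts G - {x}"
    have "?R\<^sup>*\<^sup>* u v" using G(2) n unfolding two_connected_def connected_on_def by blast
    then obtain W J where J: "arc u W J v" "J \<subseteq> {e \<in> edges G. x \<notin> e}"
      using rtranclp_arc[of ?R u v "{e \<in> edges G. x \<notin> e}"] by auto
    note b = arc_basic[OF J(1)]
    let ?A = "insert {x, u} (insert {x, v} J)"
    have nin: "{x, v} \<notin> J" "{x, u} \<notin> insert {x, v} J" using J(2) False n by (auto simp: doubleton_eq_iff)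
    have "odd_verts ?A = {}"
      using odd_verts_insert[of J "{x, v}"] odd_verts_insert[of "insert {x, v} J" "{x, u}"] b(2) nin
        arc_odd_verts[OF J(1)] n False by auto
    then have "?A \<in> ?Z" using b(2) J(2) uv by (auto simp: cycles_iff)
    then obtain C where C: "minimal_in ?Z C" "{x, u} \<in> C" "C \<subseteq> ?A" using minimal_through[of ?A "{x, u}"] by auto
    \<comment> \<open>The two given edges are the only ones of \<open>?A\<close> at
      \<open>x\<close>, and a cycle has even degree there.\<close>
    have "{x, v} \<in> C"
    proof (rule ccontr)
      assume "{x, v} \<notin> C"
      then have "{e \<in> C. x \<in> e} = {{x, u}}" using C J(2) by auto
      then have "deg C x = 1" unfolding deg_def by simp
      then show False using minimal_inD(1)[OF C(1)] unfolding cycles_def by (metis (mono_tags, lifting) mem_Collect_eq odd_one)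
    qed
    then show ?thesis unfolding rel_def using C by auto
  qed (simp add: rel_def)
  obtain a a' c c' where ac: "e = {a, a'}" "g = {c, c'}" "a \<in> verts G" "c \<in> verts G"
    using G(1) eg unfolding wf_graph_def by metis
  let ?R = "\<lambda>a b. {a, b} \<in> edges G \<and> a \<in> verts G \<and> b \<in> verts G"
  have "?R\<^sup>*\<^sup>* a c" using G(2) ac unfolding two_connected_def connected_on_def by blast
  \<comment> \<open>Induction along a walk from \<open>a\<close>: once one edge at a vertex is
    related to \<open>e\<close>, all edges at it are, among them the next edge of the walk.\<close>
  then have "\<forall>d. {c, d} \<in> edges G \<longrightarrow> rel e {c, d}"
  proof (induction rule: rtranclp_induct)
    case base
    then show ?case using adj eg ac by blast
  next
    case (step y z)
    have c: "{z, y} = {y, z}" by (rule insert_commute)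
    have "rel e {z, y}" "{z, y} \<in> edges G" unfolding c using step by blast+
    then show ?case using adj trans by blast
  qed
  then have "rel e g" using ac eg by blast
  then show ?thesis using eg(3) unfolding rel_def by blast
qed

lemma minimal_in_image:
  assumes Z: "Z' = \<phi> ` Z" and sub: "\<And>A B. A \<in> Z \<Longrightarrow> B \<in> Z \<Longrightarrow> \<phi> A \<subseteq> \<phi> B \<longleftrightarrow> A \<subseteq> B"
    and ne: "\<And>A. \<phi> A = {} \<longleftrightarrow> A = {}" and C: "C \<in> Z"
  shows "minimal_in Z' (\<phi> C) \<longleftrightarrow> minimal_in Z C"
proof -
  have eq: "\<phi> A = \<phi> C \<longleftrightarrow> A = C" if "A \<in> Z" for A
    using sub[OF that C] sub[OF C that] by (auto simp: set_eq_subset)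
  show ?thesis using C sub[OF _ C] ne eq unfolding minimal_in_def Z by (simp add: ball_simps)
qed

text \<open>The points \<open>s a\<close> may be visited in any order; \<open>p a\<close> is the
  vertex visited just before \<open>s a\<close>. Thus the edges of the path are indexed by
  \<open>A\<close>.\<close>

lemma arc_through:
  assumes "finite A" "inj_on s A" "x \<notin> s ` A"
  shows "\<exists>p z. arc x (insert x (s ` A)) ((\<lambda>a. {p a, s a}) ` A) z \<and> inj_on (\<lambda>a. {p a, s a}) A"
  using assms
proof (induction A rule: finite_induct)
  case empty
  then show ?case using arc_refl[of x] by auto
next
  case (insert a A)
  then obtain p z where p: "arc x (insert x (s ` A)) ((\<lambda>a. {p a, s a}) ` A) z" "inj_on (\<lambda>a. {p a, s a}) A"
    by auto
  let ?p = "p(a := z)"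
  have eq: "(\<lambda>b. {?p b, s b}) ` A = (\<lambda>a. {p a, s a}) ` A" using insert(2) by (intro image_cong) auto
  have sa: "s a \<notin> insert x (s ` A)" using insert by auto
  have "arc x (insert (s a) (insert x (s ` A))) (insert {z, s a} ((\<lambda>a. {p a, s a}) ` A)) (s a)"
    by (rule arc_step[OF p(1) sa])
  moreover have "insert (s a) (insert x (s ` A)) = insert x (s ` insert a A)" by auto
  moreover have "insert {z, s a} ((\<lambda>a. {p a, s a}) ` A) = (\<lambda>b. {?p b, s b}) ` insert a A"
    using eq by simp
  ultimately have arc: "arc x (insert x (s ` insert a A)) ((\<lambda>b. {?p b, s b}) ` insert a A) (s a)" by simp
  have inj0: "inj_on (\<lambda>b. {?p b, s b}) A"
    using p(2) insert(2) by (auto simp: inj_on_def)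
  have "{z, s a} \<notin> (\<lambda>b. {?p b, s b}) ` A"
    unfolding eq using arc_basic(5)[OF p(1)] sa by blast
  then have "inj_on (\<lambda>b. {?p b, s b}) (insert a A)"
    using inj0 insert(2) by (simp add: inj_on_insert)
  then show ?case using arc by blast
qed

section \<open>Contracting a partition into series classes\<close>

text \<open>\<open>cls e\<close> is the representative of the class of \<open>e\<close>.\<close>
locale series_partition =
  fixes E :: "'v set set" and cls :: "'v set \<Rightarrow> 'v set"
  assumes card_edge: "e \<in> E \<Longrightarrow> card e = 2"
    and cls_mem: "e \<in> E \<Longrightarrow> cls e \<in> E"
    and cls_idem: "e \<in> E \<Longrightarrow> cls (cls e) = cls e"
    and finite_class: "e \<in> E \<Longrightarrow> finite {g \<in> E. cls g = e}"
    and saturated: "A \<in> cycles E \<Longrightarrow> e \<in> A \<Longrightarrow> g \<in> E \<Longrightarrow> cls g = cls e \<Longrightarrow> g \<in> A"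
    and three_classes: "A \<in> cycles E \<Longrightarrow> A \<noteq> {} \<Longrightarrow> 3 \<le> card (cls ` A)"
begin

definition reps :: "'v set set" where "reps = {e \<in> E. cls e = e}"
definition forest :: "'v set set" where "forest = {e \<in> E. cls e \<noteq> e}"
definition span :: "'v set set \<Rightarrow> 'v set set" where "span D = {e \<in> E. cls e \<in> D}"

lemma cls_reps: "e \<in> E \<Longrightarrow> cls e \<in> reps"
  using cls_mem cls_idem by (auto simp: reps_def)

lemma repsD: "e \<in> reps \<Longrightarrow> e \<in> E \<and> cls e = e"
  by (simp add: reps_def)

text \<open>By saturation a cycle contains the representative of each of its edges, and
  representatives are not in the forest.\<close>

lemma forest_acyclic:
  assumes "A \<in> cycles E" "A \<subseteq> forest" shows "A = {}"
proof (rule ccontr)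
  assume "A \<noteq> {}"
  then obtain e where e: "e \<in> A" by auto
  then have eE: "e \<in> E" using assms(2) by (auto simp: forest_def)
  then have "cls e \<in> A" using saturated[OF assms(1) e cls_mem] cls_idem by auto
  then show False using assms(2) cls_idem[OF eE] by (auto simp: forest_def)
qed

section \<open>Rooting the trees of the forest\<close>

definition joined :: "'v \<Rightarrow> 'v \<Rightarrow> bool" where
  "joined = (\<lambda>a b. {a, b} \<in> forest)\<^sup>*\<^sup>*"

text \<open>The choice depends only on the predicate \<open>joined v\<close>, which is the same for
  all vertices of a tree; so every tree receives a single root.\<close>

definition root :: "'v \<Rightarrow> 'v" where "root v = (SOME w. joined v w)"

lemma joined_sym: "joined u v \<Longrightarrow> joined v u"
  unfolding joined_def by (rule sympD[OF symp_rtranclp]) (auto simp: symp_def insert_commute)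

lemma joined_trans: "joined u v \<Longrightarrow> joined v w \<Longrightarrow> joined u w"
  unfolding joined_def by (rule rtranclp_trans)

lemma joined_root: "joined v (root v)"
  unfolding root_def by (rule someI[of _ v]) (simp add: joined_def)

lemma root_eq_iff: "root u = root v \<longleftrightarrow> joined u v"
proof
  assume "root u = root v"
  then show "joined u v" using joined_root[of u] joined_root[of v] joined_sym joined_trans by metis
next
  assume "joined u v"
  then have "joined u = joined v" using joined_sym joined_trans by blast
  then show "root u = root v" by (simp add: root_def)
qed

lemma root_idem: "root (root v) = root v"
  using joined_root[of v] joined_sym root_eq_iff by blast

lemma joined_arc: "joined u v \<Longrightarrow> \<exists>W J. arc u W J v \<and> J \<subseteq> forest"
  unfolding joined_def by (rule rtranclp_arc)

lemma forest_subset: "forest \<subseteq> E"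
  by (auto simp: forest_def)

text \<open>The difference of two forest sets with equal boundary is a cycle in the forest.\<close>

lemma forest_unique:
  assumes "finite J" "finite J'" "J \<subseteq> forest" "J' \<subseteq> forest" "odd_verts J = odd_verts J'"
  shows "J = J'"
proof -
  have "odd_verts (sym_diff J J') = {}" using odd_verts_sym_diff[OF assms(1,2)] assms(5) by simp
  then have "sym_diff J J' \<in> cycles E" using assms(1-4) forest_subset by (auto simp: cycles_iff)
  then have "sym_diff J J' = {}" using forest_acyclic assms(3,4) by blast
  then show ?thesis by blast
qed

lemma root_path_exists: "\<exists>J W. arc (root v) W J v \<and> J \<subseteq> forest"
  using joined_arc[OF joined_sym[OF joined_root[of v]]] by blast

definition root_path :: "'v \<Rightarrow> 'v set set" where
  "root_path v = (SOME J. \<exists>W. arc (root v) W J v \<and> J \<subseteq> forest)"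

lemma root_path: "\<exists>W. arc (root v) W (root_path v) v" "root_path v \<subseteq> forest"
  using someI_ex[OF root_path_exists[of v]] unfolding root_path_def by auto

lemma root_path_facts:
  shows "finite (root_path v)" "odd_verts (root_path v) = sym_diff {root v} {v}"
    "root v = v \<longleftrightarrow> root_path v = {}" "root v \<noteq> v \<Longrightarrow> deg (root_path v) v = 1"
proof -
  obtain W where W: "arc (root v) W (root_path v) v" using root_path(1) by blast
  show "finite (root_path v)" by (rule arc_basic(2)[OF W])
  show "odd_verts (root_path v) = sym_diff {root v} {v}" by (rule arc_odd_verts[OF W])
  show t: "root v = v \<longleftrightarrow> root_path v = {}" by (rule arc_basic(7)[OF W])
  show "deg (root_path v) v = 1" if "root v \<noteq> v" using arc_deg[OF W, of v] t that by simp
qed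

text \<open>The root paths of the two ends of \<open>e\<close> differ by a forest set with the
  boundary of \<open>e\<close>, hence by \<open>e\<close> alone. So exactly one of them uses
  \<open>e\<close>.\<close>

lemma forest_edge_in_root_path:
  assumes "e \<in> forest"
  shows "\<exists>v. v \<in> e \<and> e \<in> root_path v"
proof -
  obtain u v where e: "e = {u, v}" "u \<noteq> v"
    using assms card_edge[of e] forest_subset by (auto simp: card_2_iff)
  have "joined u v" unfolding joined_def using assms e by auto
  then have r: "root u = root v" by (simp add: root_eq_iff)
  let ?J = "sym_diff (root_path u) (root_path v)"
  have "odd_verts ?J = sym_diff (sym_diff {root v} {u}) (sym_diff {root v} {v})"
    unfolding odd_verts_sym_diff[OF root_path_facts(1) root_path_facts(1)] root_path_facts(2) r by (rule refl)
  also have "\<dots> = {u, v}" using e(2) by auto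
  also have "\<dots> = odd_verts {e}" using e(1) by simp
  finally have "?J = {e}"
    by (rule forest_unique[rotated 4]) (use root_path_facts(1) root_path(2) assms in auto)
  then have "e \<in> ?J" by simp
  then show ?thesis unfolding e(1) by blast
qed

text \<open>Of the two endpoints of a forest edge, the tip is the one farther from the root.\<close>
definition tip :: "'v set \<Rightarrow> 'v" where
  "tip e = (SOME v. v \<in> e \<and> e \<in> root_path v)"

lemma tip: "e \<in> forest \<Longrightarrow> tip e \<in> e \<and> e \<in> root_path (tip e)"
  unfolding tip_def by (rule someI_ex[OF forest_edge_in_root_path])

text \<open>The root path of a root is empty. Tips are therefore free to serve as subdividing
  vertices, the roots being the vertices of the contraction.\<close>

lemma tip_not_root:
  assumes "e \<in> forest" shows "tip e \<noteq> root v"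
proof
  assume "tip e = root v"
  then have "root (tip e) = tip e" using root_idem by simp
  then have "root_path (tip e) = {}" using root_path_facts(3) by simp
  then show False using tip[OF assms] by simp
qed

text \<open>The root path of a tip ends there, so only one of its edges is at the tip.\<close>

lemma inj_on_tip: "inj_on tip forest"
proof (rule inj_onI)
  fix e g assume eg: "e \<in> forest" "g \<in> forest" "tip e = tip g"
  let ?v = "tip e"
  have "root_path ?v \<noteq> {}" using tip[OF eg(1)] by blast
  then have "deg (root_path ?v) ?v = 1" using root_path_facts(3,4)[of ?v] by simp
  then obtain a where "{e \<in> root_path ?v. ?v \<in> e} = {a}" unfolding deg_def by (rule card_1_singletonE)
  moreover have "e \<in> {e \<in> root_path ?v. ?v \<in> e}" "g \<in> {e \<in> root_path ?v. ?v \<in> e}"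
    using tip[OF eg(1)] tip[OF eg(2)] eg(3) by simp_all
  ultimately have "e \<in> {a}" "g \<in> {a}" by (simp_all only:)
  then show "e = g" by simp
qed

section \<open>Parities across the components, and the cycles of the contraction\<close>

definition component :: "'v \<Rightarrow> 'v set" where "component w = {v. root v = w}"

lemma edge_component_parity:
  assumes "e \<in> E" "card (root ` e) = 2"
  shows "odd (card (e \<inter> component w)) \<longleftrightarrow> w \<in> root ` e"
proof -
  obtain u v where e: "e = {u, v}" "u \<noteq> v" using card_edge[OF assms(1)] by (auto simp: card_2_iff)
  have "root u \<noteq> root v" using assms(2) e by auto
  then show ?thesis unfolding component_def e by (cases "root u = w"; cases "root v = w") (auto simp: Int_insert_left)
qed

lemma edge_component_even:
  assumes "e \<in> E" "card (root ` e) \<noteq> 2"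
  shows "even (card (e \<inter> component w))"
proof -
  obtain u v where e: "e = {u, v}" "u \<noteq> v" using card_edge[OF assms(1)] by (auto simp: card_2_iff)
  have "root u = root v" by (rule ccontr) (use assms(2) e in simp)
  then show ?thesis unfolding component_def e using e(2) by (cases "root v = w") (auto simp: Int_insert_left)
qed

lemma forest_component_even:
  assumes "e \<in> forest" shows "even (card (e \<inter> component w))"
proof -
  have eE: "e \<in> E" using assms forest_subset by auto
  obtain u v where e: "e = {u, v}" using card_edge[OF eE] by (auto simp: card_2_iff)
  have "joined u v" unfolding joined_def using assms e by auto
  then have "root v = root u" using root_eq_iff[of u v] by simp
  then have "root ` e = {root u}" using e by simp
  then show ?thesis using edge_component_even[OF eE] by simp
qed

text \<open>Existence of a T-join: a component containing a point of \<open>T\<close> contains a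
  second one. Join the two by a forest path and continue with the rest of \<open>T\<close>.\<close>

lemma forest_join:
  assumes "finite T" "\<And>w. even (card (T \<inter> component w))"
  shows "\<exists>J. finite J \<and> J \<subseteq> forest \<and> odd_verts J = T"
  using assms
proof (induction "card T" arbitrary: T rule: less_induct)
  case less
  show ?case
  proof (cases "T = {}")
    case True
    then show ?thesis by (intro exI[of _ "{}"]) simp
  next
    case False
    then obtain t where t: "t \<in> T" by auto
    let ?X = "T \<inter> component (root t)"
    have tX: "t \<in> ?X" using t by (simp add: component_def)
    have "\<not> ?X \<subseteq> {t}"
    proof
      assume "?X \<subseteq> {t}"
      then have "?X = {t}" using tX by (metis empty_iff subset_singletonD)
      then show False using less(3)[of "root t"] by simp
    qed
    then obtain t' where t': "t' \<in> ?X" "t' \<noteq> t" by blast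
    then have j: "joined t t'" using root_eq_iff[of t t'] by (simp add: component_def)
    then obtain W J where J: "arc t W J t'" "J \<subseteq> forest" using joined_arc by blast
    have "sym_diff {t} {t'} = {t, t'}" using t'(2) by auto
    then have oJ: "odd_verts J = {t, t'}" using arc_odd_verts[OF J(1)] by simp
    let ?T = "T - {t, t'}"
    have tt: "{t, t'} \<subseteq> T" using t t' by auto
    then have c: "card ?T < card T" using less(2) t by (intro psubset_card_mono) auto
    have ev: "even (card (?T \<inter> component w))" for w
    proof -
      have eq: "?T \<inter> component w = (T \<inter> component w) - ({t, t'} \<inter> component w)" by auto
      have "card ({t, t'} \<inter> component w) \<in> {0, 2}"
      proof (cases "root t = w")
        case True
        then have "{t, t'} \<inter> component w = {t, t'}" using root_eq_iff[of t t'] j by (simp add: component_def)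
        then show ?thesis using t'(2) by simp
      next
        case False
        then have "{t, t'} \<inter> component w = {}" using root_eq_iff[of t t'] j by (simp add: component_def)
        then show ?thesis by simp
      qed
      then have "even (card ({t, t'} \<inter> component w))" by auto
      moreover have "card (?T \<inter> component w) = card (T \<inter> component w) - card ({t, t'} \<inter> component w)"
        unfolding eq by (rule card_Diff_subset) (use tt in auto)
      ultimately show ?thesis using less(3)[of w] by (simp only: dvd_diff_nat)
    qed
    obtain J' where J': "finite J'" "J' \<subseteq> forest" "odd_verts J' = ?T"
      using less(1)[OF c finite_Diff[OF less(2)] ev] by blast
    \<comment> \<open>The new path may overlap \<open>J'\<close>, so the two are combined by
      symmetric difference.\<close>
    have "sym_diff {t, t'} (T - {t, t'}) = T" using tt by blast
    then have "odd_verts (sym_diff J J') = T"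
      unfolding odd_verts_sym_diff[OF arc_basic(2)[OF J(1)] J'(1)] oJ J'(3) .
    moreover have "finite (sym_diff J J')" "sym_diff J J' \<subseteq> forest" using arc_basic(2)[OF J(1)] J' J(2) by auto
    ultimately show ?thesis by (intro exI[of _ "sym_diff J J'"]) simp
  qed
qed

lemma odd_component_parity:
  assumes "finite D" "D \<subseteq> E"
  shows "even (card (odd_verts D \<inter> component w)) \<longleftrightarrow> even (card {e \<in> D. odd (card (e \<inter> component w))})"
proof -
  have "finite e" if "e \<in> D" for e using card_edge[of e] that assms(2) by (intro card_ge_0_finite) auto
  then show ?thesis using odd_verts_parity[OF assms(1), of "component w"] by blast
qed

lemma finite_odd_verts:
  assumes "finite D" "D \<subseteq> E" shows "finite (odd_verts D)"
proof -
  have "finite e" if "e \<in> D" for e using card_edge[of e] that assms(2) by (intro card_ge_0_finite) auto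
  then show ?thesis using odd_verts_parity[OF assms(1)] by blast
qed

lemma span_eq_Un: "D \<subseteq> reps \<Longrightarrow> span D = D \<union> (span D \<inter> forest)"
  by (auto simp: span_def reps_def forest_def)

lemma cycle_eq_span:
  assumes "A \<in> cycles E" shows "A = span (A \<inter> reps)"
proof -
  have AE: "A \<subseteq> E" using assms by (simp add: cycles_def)
  have "e \<in> A \<longleftrightarrow> cls e \<in> A" if e: "e \<in> E" for e
    using saturated[OF assms] e cls_mem[OF e] cls_idem[OF e] by metis
  then show ?thesis using AE cls_reps by (auto simp: span_def)
qed

lemma finite_span:
  assumes "finite D" "D \<subseteq> reps" shows "finite (span D)"
proof -
  have "span D = (\<Union>e\<in>D. {g \<in> E. cls g = e})" by (auto simp: span_def)
  then show ?thesis using assms finite_class repsD by auto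
qed

text \<open>Forest edges never leave a component, so a cycle forces \<open>D\<close> to leave each
  one evenly often. Conversely, evenness lets a forest set cancel the boundary of \<open>D\<close>,
  and by saturation the resulting cycle can only be \<open>span D\<close>.\<close>

lemma span_cycle_iff:
  assumes D: "finite D" "D \<subseteq> reps"
  shows "span D \<in> cycles E \<longleftrightarrow> (\<forall>w. even (card {e \<in> D. odd (card (e \<inter> component w))}))"
proof
  have DE: "D \<subseteq> E" using D(2) by (auto simp: reps_def)
  let ?J = "span D \<inter> forest"
  assume sp: "span D \<in> cycles E"
  have fJ: "finite ?J" using sp by (simp add: cycles_def)
  have "D \<inter> ?J = {}" using D(2) by (auto simp: reps_def forest_def)
  then have "odd_verts (span D) = sym_diff (odd_verts D) (odd_verts ?J)"
    using odd_verts_Un_disjoint[OF D(1) fJ] span_eq_Un[OF D(2)] by simp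
  then have eq: "odd_verts D = odd_verts ?J" using sp unfolding cycles_iff by blast
  show "\<forall>w. even (card {e \<in> D. odd (card (e \<inter> component w))})"
  proof
    fix w
    have "{e \<in> ?J. odd (card (e \<inter> component w))} = {}" using forest_component_even by auto
    then have "even (card (odd_verts ?J \<inter> component w))"
      using odd_component_parity[OF fJ, of w] forest_subset by (metis (no_types, lifting) card.empty dvd_0_right inf.coboundedI2)
    then show "even (card {e \<in> D. odd (card (e \<inter> component w))})"
      using odd_component_parity[OF D(1) DE, of w] eq by simp
  qed
next
  have DE: "D \<subseteq> E" using D(2) by (auto simp: reps_def)
  assume "\<forall>w. even (card {e \<in> D. odd (card (e \<inter> component w))})"
  then have "even (card (odd_verts D \<inter> component w))" for w
    using odd_component_parity[OF D(1) DE] by simp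
  then obtain J where J: "finite J" "J \<subseteq> forest" "odd_verts J = odd_verts D"
    using forest_join[OF finite_odd_verts[OF D(1) DE]] by blast
  have dis: "D \<inter> J = {}" using D(2) J(2) by (auto simp: reps_def forest_def)
  have "odd_verts (D \<union> J) = {}" using odd_verts_Un_disjoint[OF D(1) J(1) dis] J(3) by simp
  then have Z: "D \<union> J \<in> cycles E" using D DE J forest_subset by (auto simp: cycles_iff)
  have "(D \<union> J) \<inter> reps = D" using D(2) J(2) by (auto simp: reps_def forest_def)
  then show "span D \<in> cycles E" using cycle_eq_span[OF Z] Z by simp
qed

text \<open>Cycles meet at least three classes; this keeps the contraction free of loops (one class)
  and of parallel edges (two classes).\<close>

lemma span_not_cycle:
  assumes "D \<subseteq> reps" "D \<noteq> {}" "finite D" "card D < 3"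
  shows "span D \<notin> cycles E"
proof
  assume Z: "span D \<in> cycles E"
  have "D \<subseteq> span D" using assms(1) by (auto simp: span_def reps_def)
  then have "span D \<noteq> {}" using assms(2) by blast
  then have "3 \<le> card (cls ` span D)" using three_classes Z by blast
  also have "\<dots> \<le> card D" using assms(3) by (intro card_mono) (auto simp: span_def)
  finally show False using assms(4) by simp
qed

lemma card_root_image:
  assumes "e \<in> reps" shows "card (root ` e) = 2"
proof (rule ccontr)
  assume n: "card (root ` e) \<noteq> 2"
  have eE: "e \<in> E" using assms repsD by blast
  have "{g \<in> {e}. odd (card (g \<inter> component w))} = {}" for w using edge_component_even[OF eE n] by auto
  then have "span {e} \<in> cycles E" using span_cycle_iff[of "{e}"] assms by (metis (no_types, lifting) card.empty empty_subsetI even_zero finite.emptyI finite_insert insert_subset)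
  then show False using span_not_cycle[of "{e}"] assms by simp
qed

lemma inj_on_root_image: "inj_on ((`) root) reps"
proof (rule inj_onI, rule ccontr)
  fix e g assume eg: "e \<in> reps" "g \<in> reps" "root ` e = root ` g" "e \<noteq> g"
  have "even (card {h \<in> {e, g}. odd (card (h \<inter> component w))})" for w
  proof -
    have "odd (card (h \<inter> component w)) \<longleftrightarrow> w \<in> root ` e" if "h \<in> {e, g}" for h
      using edge_component_parity[of h w] card_root_image repsD eg that by auto
    then have "{h \<in> {e, g}. odd (card (h \<inter> component w))} = (if w \<in> root ` e then {e, g} else {})" by auto
    then show ?thesis using eg(4) by simp
  qed
  then have "span {e, g} \<in> cycles E" using span_cycle_iff[of "{e, g}"] eg by simp
  moreover have "card {e, g} < 3" using eg(4) by simp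
  ultimately show False using span_not_cycle[of "{e, g}"] eg by blast
qed

text \<open>The degree of \<open>w\<close> in the contraction counts the edges of \<open>D\<close>
  that leave the component of \<open>w\<close>.\<close>

lemma span_cycle_iff_contracted:
  assumes D: "finite D" "D \<subseteq> reps"
  shows "span D \<in> cycles E \<longleftrightarrow> (`) root ` D \<in> cycles ((`) root ` reps)"
proof -
  have "deg ((`) root ` D) w = card {e \<in> D. odd (card (e \<inter> component w))}" for w
  proof -
    have "w \<in> root ` e \<longleftrightarrow> odd (card (e \<inter> component w))" if "e \<in> D" for e
      using edge_component_parity[of e w] card_root_image repsD D(2) that by blast
    then have "{g \<in> (`) root ` D. w \<in> g} = (`) root ` {e \<in> D. odd (card (e \<inter> component w))}" by blast
    moreover have "inj_on ((`) root) {e \<in> D. odd (card (e \<inter> component w))}"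
      using inj_on_root_image D(2) by (auto intro: inj_on_subset)
    ultimately show ?thesis unfolding deg_def by (simp add: card_image)
  qed
  then show ?thesis unfolding span_cycle_iff[OF D] using D by (auto simp: cycles_def)
qed

section \<open>Subdividing the contracted graph\<close>

definition members :: "'v set \<Rightarrow> 'v set set" where "members e = {a \<in> E. cls a = e}"
definition twigs :: "'v set \<Rightarrow> 'v set set" where "twigs e = {a \<in> forest. cls a = e}"

lemma members_eq: "e \<in> reps \<Longrightarrow> members e = insert e (twigs e)"
  by (auto simp: members_def twigs_def forest_def reps_def)

lemma finite_twigs: "e \<in> reps \<Longrightarrow> finite (twigs e)"
  using finite_class[of e] finite_subset[of "twigs e" "{g \<in> E. cls g = e}"]
  by (auto simp: twigs_def forest_def reps_def)

lemma root_tip_disjoint: "root ` X \<inter> tip ` twigs e = {}"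
proof (rule equals0I)
  fix v assume "v \<in> root ` X \<inter> tip ` twigs e"
  then show False using tip_not_root by (auto simp: twigs_def) metis
qed

text \<open>The path starts at one root, visits the tips of all twigs, and ends at the other root.
  The last conjunct makes every edge of a subdivided chain reveal its class.\<close>

lemma chain_exists:
  assumes e: "e \<in> reps"
  shows "\<exists>\<kappa> x y. root ` e = {x, y} \<and> arc x (root ` e \<union> tip ` twigs e) (\<kappa> ` members e) y \<and>
    inj_on \<kappa> (members e) \<and> (\<forall>a\<in>members e. twigs e \<noteq> {} \<longrightarrow> \<kappa> a \<inter> tip ` twigs e \<noteq> {})"
proof -
  obtain x y where xy: "root ` e = {x, y}" "x \<noteq> y" using card_root_image[OF e] by (auto simp: card_2_iff)
  have "x \<in> root ` e" "y \<in> root ` e" using xy by simp_all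
  then have nt: "x \<notin> tip ` twigs e" "y \<notin> tip ` twigs e" using root_tip_disjoint[of e e] by blast+
  have "inj_on tip (twigs e)" using inj_on_tip by (rule inj_on_subset) (auto simp: twigs_def)
  from arc_through[OF finite_twigs[OF e] this nt(1)] obtain p z where
    p: "arc x (insert x (tip ` twigs e)) ((\<lambda>a. {p a, tip a}) ` twigs e) z"
    and inj: "inj_on (\<lambda>a. {p a, tip a}) (twigs e)" by blast
  \<comment> \<open>A twig gets the edge arriving at its tip; the representative gets the final edge
    into \<open>y\<close>. Without twigs \<open>z\<close> is \<open>x\<close>, and that edge joins
    the two roots.\<close>
  define \<kappa> where "\<kappa> = (\<lambda>a. if a = e then {z, y} else {p a, tip a})"
  have en: "e \<notin> twigs e" using e by (auto simp: twigs_def forest_def reps_def)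
  have im: "\<kappa> ` twigs e = (\<lambda>a. {p a, tip a}) ` twigs e"
    using en unfolding \<kappa>_def by (intro image_cong) auto
  have yn: "y \<notin> insert x (tip ` twigs e)" using nt xy(2) by simp
  have "arc x (insert y (insert x (tip ` twigs e))) (insert {z, y} ((\<lambda>a. {p a, tip a}) ` twigs e)) y"
    by (rule arc_step[OF p yn])
  moreover have "insert y (insert x (tip ` twigs e)) = root ` e \<union> tip ` twigs e" unfolding xy(1) by auto
  moreover have "insert {z, y} ((\<lambda>a. {p a, tip a}) ` twigs e) = \<kappa> ` members e"
    unfolding members_eq[OF e] image_insert im by (simp add: \<kappa>_def)
  ultimately have arc: "arc x (root ` e \<union> tip ` twigs e) (\<kappa> ` members e) y" by simp
  have inj0: "inj_on \<kappa> (twigs e)" using inj en by (auto simp: inj_on_def \<kappa>_def)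
  have "{z, y} \<notin> (\<lambda>a. {p a, tip a}) ` twigs e" using arc_basic(5)[OF p] yn by blast
  then have "\<kappa> e \<notin> \<kappa> ` twigs e" unfolding im by (simp add: \<kappa>_def)
  then have inj1: "inj_on \<kappa> (members e)" unfolding members_eq[OF e] using inj0 en by simp
  have "\<kappa> a \<inter> tip ` twigs e \<noteq> {}" if a: "a \<in> members e" and ne: "twigs e \<noteq> {}" for a
  proof (cases "a = e")
    case True
    have "z \<noteq> x" using arc_basic(7)[OF p] ne by simp
    then have "z \<in> tip ` twigs e" using arc_basic(4)[OF p] by simp
    then show ?thesis using True by (simp add: \<kappa>_def)
  next
    case False
    then have "a \<in> twigs e" using a members_eq[OF e] by simp
    then show ?thesis using False by (simp add: \<kappa>_def)
  qed
  then show ?thesis using xy arc inj1 by (intro exI[of _ \<kappa>] exI[of _ x] exI[of _ y]) simp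
qed

text \<open>The choice is made once per class, since the chosen \<open>\<kappa>\<close> depends on \<open>cls a\<close> only.\<close>
definition stretch :: "'v set \<Rightarrow> 'v set" where
  "stretch a = (SOME \<kappa>. \<exists>x y. root ` cls a = {x, y} \<and>
     arc x (root ` cls a \<union> tip ` twigs (cls a)) (\<kappa> ` members (cls a)) y \<and> inj_on \<kappa> (members (cls a)) \<and>
     (\<forall>b\<in>members (cls a). twigs (cls a) \<noteq> {} \<longrightarrow> \<kappa> b \<inter> tip ` twigs (cls a) \<noteq> {})) a"

definition chain :: "'v set \<Rightarrow> 'v set set" where "chain e = stretch ` members e"

lemma stretch_chain:
  assumes e: "e \<in> reps"
  shows "\<exists>x y. root ` e = {x, y} \<and> arc x (root ` e \<union> tip ` twigs e) (chain e) y"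
    and "inj_on stretch (members e)"
    and "a \<in> members e \<Longrightarrow> twigs e \<noteq> {} \<Longrightarrow> stretch a \<inter> tip ` twigs e \<noteq> {}"
proof -
  let ?P = "\<lambda>\<kappa>. \<exists>x y. root ` e = {x, y} \<and>
     arc x (root ` e \<union> tip ` twigs e) (\<kappa> ` members e) y \<and> inj_on \<kappa> (members e) \<and>
     (\<forall>b\<in>members e. twigs e \<noteq> {} \<longrightarrow> \<kappa> b \<inter> tip ` twigs e \<noteq> {})"
  define \<kappa> where "\<kappa> = (SOME \<kappa>. ?P \<kappa>)"
  have P: "?P \<kappa>" unfolding \<kappa>_def by (rule someI_ex[OF chain_exists[OF e]])
  have eq: "stretch a = \<kappa> a" if "a \<in> members e" for a
    using that unfolding stretch_def \<kappa>_def members_def by simp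
  have "chain e = \<kappa> ` members e" unfolding chain_def using eq by (rule image_cong[OF refl])
  then show "\<exists>x y. root ` e = {x, y} \<and> arc x (root ` e \<union> tip ` twigs e) (chain e) y" using P by auto
  have "inj_on \<kappa> (members e)" using P by auto
  then show "inj_on stretch (members e)" using eq inj_on_cong[of "members e" stretch \<kappa>] by simp
  show "stretch a \<inter> tip ` twigs e \<noteq> {}" if "a \<in> members e" "twigs e \<noteq> {}" using P eq[OF that(1)] that by auto
qed

lemma chainE:
  assumes "e \<in> reps"
  obtains x y where "root ` e = {x, y}" "x \<noteq> y" "arc x (root ` e \<union> tip ` twigs e) (chain e) y"
proof -
  obtain x y where *: "root ` e = {x, y}" "arc x (root ` e \<union> tip ` twigs e) (chain e) y"
    using stretch_chain(1)[OF assms] by blast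
  then have "x \<noteq> y" using card_root_image[OF assms] by auto
  then show ?thesis using that * by blast
qed

lemma mem_members_cls: "a \<in> E \<Longrightarrow> a \<in> members (cls a)"
  by (simp add: members_def)

lemma Union_chain:
  assumes "e \<in> reps" shows "\<Union>(chain e) = root ` e \<union> tip ` twigs e"
proof -
  obtain x y where xy: "root ` e = {x, y}" "x \<noteq> y" and a: "arc x (root ` e \<union> tip ` twigs e) (chain e) y"
    by (rule chainE[OF assms])
  have "chain e \<noteq> {}" using arc_basic(7)[OF a] xy(2) by simp
  then have "deg (chain e) x = 1" using arc_deg[OF a, of x] by simp
  then obtain g where "{h \<in> chain e. x \<in> h} = {g}" unfolding deg_def by (rule card_1_singletonE)
  then have "x \<in> \<Union>(chain e)" by auto
  then have "insert x (\<Union>(chain e)) = \<Union>(chain e)" by (rule insert_absorb)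
  then show ?thesis using arc_basic(5)[OF a] by (simp only:)
qed

lemma stretch_edge:
  assumes "a \<in> E"
  shows "stretch a \<subseteq> root ` cls a \<union> tip ` twigs (cls a)" "card (stretch a) = 2"
proof -
  have s: "stretch a \<in> chain (cls a)" unfolding chain_def using mem_members_cls[OF assms] by (rule imageI)
  have r: "cls a \<in> reps" by (rule cls_reps[OF assms])
  show "stretch a \<subseteq> root ` cls a \<union> tip ` twigs (cls a)" using s Union_chain[OF r] by blast
  obtain x y where "arc x (root ` cls a \<union> tip ` twigs (cls a)) (chain (cls a)) y"
    by (rule chainE[OF r])
  from arc_basic(6)[OF this] show "card (stretch a) = 2" using s by blast
qed

lemma stretch_trivial:
  assumes "a \<in> E" "twigs (cls a) = {}" shows "stretch a = root ` cls a" "a = cls a"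
proof -
  have "finite (root ` cls a)" using card_root_image[OF cls_reps[OF assms(1)]] by (intro card_ge_0_finite) simp
  then show "stretch a = root ` cls a"
    using stretch_edge[OF assms(1)] card_root_image[OF cls_reps[OF assms(1)]] assms(2) by (simp add: card_subset_eq)
  show "a = cls a" using mem_members_cls[OF assms(1)] members_eq[OF cls_reps[OF assms(1)]] assms(2) by simp
qed

text \<open>A tip is never a root and belongs to only one twig, so it is interior to one chain
  only.\<close>

lemma tip_in_stretch:
  assumes "c \<in> twigs e" "b \<in> E" "tip c \<in> stretch b" shows "cls b = e"
proof -
  have "tip c \<notin> root ` cls b" using assms(1) tip_not_root[of c] by (auto simp: twigs_def)
  then obtain d where d: "d \<in> twigs (cls b)" "tip c = tip d" using stretch_edge(1)[OF assms(2)] assms(3) by blast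
  then have "c = d" using inj_on_tip assms(1) by (auto simp: twigs_def dest: inj_onD)
  then show ?thesis using d(1) assms(1) by (simp add: twigs_def)
qed

text \<open>Edges of subdivided chains contain a tip, which determines the class; unsubdivided ones
  are root images of representatives, which are distinct. Within a class the choice of
  \<open>stretch\<close> is injective.\<close>

lemma inj_on_stretch: "inj_on stretch E"
proof (rule inj_onI)
  fix a b assume ab: "a \<in> E" "b \<in> E" "stretch a = stretch b"
  have tw: "cls b = cls a" if "twigs (cls a) \<noteq> {}" "a \<in> E" "b \<in> E" "stretch a = stretch b" for a b
  proof -
    have "stretch a \<inter> tip ` twigs (cls a) \<noteq> {}"
      by (rule stretch_chain(3)[OF cls_reps[OF that(2)] mem_members_cls[OF that(2)] that(1)])
    then obtain c where "c \<in> twigs (cls a)" "tip c \<in> stretch a" by blast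
    then show ?thesis using tip_in_stretch that by blast
  qed
  have "cls a = cls b"
  proof (cases "twigs (cls a) = {} \<and> twigs (cls b) = {}")
    case True
    then have "root ` cls a = root ` cls b" using stretch_trivial(1) ab by metis
    then show ?thesis using inj_onD[OF inj_on_root_image] cls_reps ab by blast
  next
    case False
    then show ?thesis using tw[of a b] tw[of b a] ab by metis
  qed
  then have "a \<in> members (cls a)" "b \<in> members (cls a)" using ab by (simp_all add: members_def)
  then show "a = b" using inj_onD[OF stretch_chain(2)[OF cls_reps[OF ab(1)]] ab(3)] by blast
qed

lemma span_insert: "span (insert e D) = members e \<union> span D"
  by (auto simp: span_def members_def)

lemma odd_verts_chain:
  assumes "e \<in> reps" shows "odd_verts (chain e) = root ` e"
proof -
  obtain x y where xy: "root ` e = {x, y}" "x \<noteq> y" and a: "arc x (root ` e \<union> tip ` twigs e) (chain e) y"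
    by (rule chainE[OF assms])
  have "odd_verts (chain e) = sym_diff {x} {y}" by (rule arc_odd_verts[OF a])
  also have "\<dots> = {x, y}" using xy(2) by auto
  finally show ?thesis using xy(1) by simp
qed

lemma finite_chain: "e \<in> reps \<Longrightarrow> finite (chain e)"
  unfolding chain_def members_eq using finite_twigs by simp

text \<open>A chain has the same boundary as the single edge that it subdivides.\<close>

lemma odd_verts_stretch_span:
  assumes "finite D" "D \<subseteq> reps"
  shows "odd_verts (stretch ` span D) = odd_verts ((`) root ` D)"
  using assms
proof (induction D rule: finite_induct)
  case empty
  then show ?case by (simp add: span_def)
next
  case (insert e D)
  have e: "e \<in> reps" and D: "D \<subseteq> reps" using insert(4) by auto
  have "members e \<inter> span D = {}" using insert(2) by (auto simp: members_def span_def)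
  moreover have "members e \<subseteq> E" "span D \<subseteq> E" by (auto simp: members_def span_def)
  ultimately have dis: "chain e \<inter> stretch ` span D = {}"
    unfolding chain_def using inj_on_image_Int[OF inj_on_stretch, of "members e" "span D"] by simp
  have "stretch ` span (insert e D) = chain e \<union> stretch ` span D"
    unfolding span_insert chain_def by (rule image_Un)
  then have "odd_verts (stretch ` span (insert e D)) = sym_diff (odd_verts (chain e)) (odd_verts (stretch ` span D))"
    using odd_verts_Un_disjoint[OF finite_chain[OF e] finite_imageI[OF finite_span[OF insert(1) D]] dis] by simp
  also have "\<dots> = sym_diff (odd_verts ((`) root ` D)) (root ` e)"
    unfolding odd_verts_chain[OF e] insert(3)[OF D] by (rule Un_commute)
  also have "\<dots> = odd_verts (insert (root ` e) ((`) root ` D))"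
  proof (rule odd_verts_insert[symmetric])
    show "finite ((`) root ` D)" using insert(1) by simp
    show "root ` e \<notin> (`) root ` D" using inj_on_image_mem_iff[OF inj_on_root_image e D] insert(2) by simp
  qed
  finally show ?case by simp
qed

lemma edges_at_tip:
  assumes "c \<in> twigs e"
  shows "{g \<in> stretch ` E. tip c \<in> g} = {g \<in> chain e. tip c \<in> g}"
proof -
  have "stretch b \<in> chain e" if "b \<in> E" "tip c \<in> stretch b" for b
    using tip_in_stretch[OF assms that] that(1) by (auto simp: chain_def members_def)
  moreover have "chain e \<subseteq> stretch ` E" by (auto simp: chain_def members_def)
  ultimately show ?thesis by auto
qed

lemma deg_chain:
  assumes "e \<in> reps"
  shows "v \<in> root ` e \<Longrightarrow> deg (chain e) v = 1"
    "c \<in> twigs e \<Longrightarrow> deg (chain e) (tip c) = 2" "c \<in> twigs e \<Longrightarrow> deg (stretch ` E) (tip c) = 2"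
proof -
  obtain x y where xy: "root ` e = {x, y}" "x \<noteq> y" and a: "arc x (root ` e \<union> tip ` twigs e) (chain e) y"
    by (rule chainE[OF assms])
  have ne: "chain e \<noteq> {}" using arc_basic(7)[OF a] xy(2) by simp
  show "deg (chain e) v = 1" if "v \<in> root ` e"
    using arc_deg[OF a, of v] ne that xy(1) by auto
  show d: "deg (chain e) (tip c) = 2" if c: "c \<in> twigs e"
  proof -
    have "tip c \<in> tip ` twigs e" using c by (rule imageI)
    moreover have "tip c \<noteq> x" "tip c \<noteq> y"
    proof -
      have "tip c \<notin> root ` e" using tip_not_root c by (auto simp: twigs_def)
      then show "tip c \<noteq> x" "tip c \<noteq> y" using xy(1) by auto
    qed
    ultimately show ?thesis using arc_deg[OF a, of "tip c"] ne by simp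
  qed
  show "deg (stretch ` E) (tip c) = 2" if c: "c \<in> twigs e"
    using d[OF c] unfolding deg_def edges_at_tip[OF c] .
qed

lemma stretch_saturated:
  assumes B: "B \<in> cycles (stretch ` E)" and e: "e \<in> reps" and ab: "a \<in> members e" "b \<in> members e"
    and aB: "stretch a \<in> B"
  shows "stretch b \<in> B"
proof (rule ccontr)
  assume bB: "stretch b \<notin> B"
  obtain x y where xy: "root ` e = {x, y}" "x \<noteq> y" and a: "arc x (root ` e \<union> tip ` twigs e) (chain e) y"
    by (rule chainE[OF e])
  let ?D = "chain e \<inter> B"
  have "stretch a \<in> ?D" "stretch b \<in> chain e - ?D" using ab aB bB by (auto simp: chain_def)
  then have "?D \<subseteq> chain e" "?D \<noteq> {}" "?D \<noteq> chain e" by blast+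
  then have "\<Union>?D \<inter> \<Union>(chain e - ?D) \<noteq> {}"
    using arc_edge_connected[OF a] unfolding edge_connected_def by blast
  then obtain v g h where v: "g \<in> ?D" "v \<in> g" "h \<in> chain e - ?D" "v \<in> h" by blast
  have gh: "{g, h} \<subseteq> {k \<in> chain e. v \<in> k}" "g \<noteq> h" using v by auto
  have fin: "finite {k \<in> chain e. v \<in> k}" using finite_chain[OF e] by simp
  have "card {g, h} \<le> deg (chain e) v" unfolding deg_def by (rule card_mono[OF fin gh(1)])
  then have "2 \<le> deg (chain e) v" using gh(2) by simp
  \<comment> \<open>The ends of the chain have degree 1 in it, whereas \<open>g\<close> and
    \<open>h\<close> both contain \<open>v\<close>.\<close>
  then have "v \<notin> root ` e" using deg_chain(1)[OF e] by fastforce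
  moreover have "v \<in> root ` e \<union> tip ` twigs e" using v(1,2) Union_chain[OF e] by blast
  ultimately obtain c where c: "c \<in> twigs e" "v = tip c" by blast
  have "card {k \<in> chain e. v \<in> k} = card {g, h}"
    using deg_chain(2)[OF e c(1)] gh(2) unfolding deg_def c(2) by simp
  then have "{g, h} = {k \<in> chain e. v \<in> k}" using card_subset_eq[OF fin gh(1)] by simp
  then have gh': "{k \<in> stretch ` E. v \<in> k} = {g, h}" using edges_at_tip[OF c(1)] c(2) by simp
  have "B \<subseteq> stretch ` E" using B by (simp add: cycles_def)
  then have "{k \<in> B. v \<in> k} = {k \<in> stretch ` E. v \<in> k} \<inter> B" by blast
  also have "\<dots> = {g, h} \<inter> B" unfolding gh' ..
  also have "\<dots> = {g}" using v by auto
  finally have "deg B v = 1" by (simp add: deg_def)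
  moreover have "even (deg B v)" using B by (simp add: cycles_def)
  ultimately show False by simp
qed

lemma stretch_cycle_eq:
  assumes "B \<in> cycles (stretch ` E)"
  obtains D where "finite D" "D \<subseteq> reps" "B = stretch ` span D"
proof -
  have BE: "B \<subseteq> stretch ` E" and fB: "finite B" using assms by (auto simp: cycles_def)
  let ?A = "{a \<in> E. stretch a \<in> B}"
  have B: "B = stretch ` ?A" using BE by auto
  have "finite ?A" using fB inj_on_stretch B by (metis (no_types, lifting) finite_imageD inj_on_subset mem_Collect_eq subsetI)
  moreover have "?A = span (cls ` ?A)"
  proof -
    have "b \<in> ?A" if "b \<in> E" "a \<in> ?A" "cls b = cls a" for a b
      using stretch_saturated[OF assms cls_reps[of a], of a b] that by (simp add: members_def)
    then show ?thesis unfolding span_def by blast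
  qed
  moreover have "cls ` ?A \<subseteq> reps" using cls_reps by auto
  ultimately show ?thesis using that[of "cls ` ?A"] B by simp
qed

text \<open>Both sides are compared with the contracted graph, where \<open>D\<close> appears as its
  set of root images.\<close>

lemma stretch_span_cycle_iff:
  assumes "finite D" "D \<subseteq> reps"
  shows "stretch ` span D \<in> cycles (stretch ` E) \<longleftrightarrow> span D \<in> cycles E"
proof -
  have "span D \<subseteq> E" by (auto simp: span_def)
  then have "stretch ` span D \<in> cycles (stretch ` E) \<longleftrightarrow> odd_verts ((`) root ` D) = {}"
    unfolding cycles_iff odd_verts_stretch_span[OF assms] using finite_span[OF assms] by (simp add: image_mono)
  also have "\<dots> \<longleftrightarrow> (`) root ` D \<in> cycles ((`) root ` reps)"
    unfolding cycles_iff using assms by (simp add: image_mono)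
  also have "\<dots> \<longleftrightarrow> span D \<in> cycles E" using span_cycle_iff_contracted[OF assms] by simp
  finally show ?thesis .
qed

lemma cycleE:
  assumes "A \<in> cycles E"
  obtains D where "finite D" "D \<subseteq> reps" "A = span D"
proof (rule that)
  show "finite (A \<inter> reps)" using assms by (simp add: cycles_def)
  show "A = span (A \<inter> reps)" by (rule cycle_eq_span[OF assms])
qed simp

lemma stretch_cycles: "cycles (stretch ` E) = (`) stretch ` cycles E"
proof (intro equalityI subsetI)
  fix B assume B: "B \<in> cycles (stretch ` E)"
  then obtain D where D: "finite D" "D \<subseteq> reps" "B = stretch ` span D" by (rule stretch_cycle_eq)
  then have "span D \<in> cycles E" using stretch_span_cycle_iff[OF D(1,2)] B by simp
  then show "B \<in> (`) stretch ` cycles E" using D(3) by blast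
next
  fix B assume "B \<in> (`) stretch ` cycles E"
  then obtain A where A: "A \<in> cycles E" "B = stretch ` A" by blast
  obtain D where D: "finite D" "D \<subseteq> reps" "A = span D" using A(1) by (rule cycleE)
  then show "B \<in> cycles (stretch ` E)" using stretch_span_cycle_iff[OF D(1,2)] A by simp
qed

section \<open>The contraction map and the correspondence of circuits\<close>

definition contract :: "'v set \<Rightarrow> 'v set" where "contract a = root ` cls a"

lemma contract_span: "D \<subseteq> reps \<Longrightarrow> contract ` span D = (`) root ` D"
  by (force simp: contract_def span_def reps_def)

lemma contract_edges: "contract ` E = (`) root ` reps"
proof -
  have "cls ` E = reps" using cls_reps repsD by force
  then show ?thesis unfolding contract_def by (metis image_image)
qed

lemma contract_eq_iff: "a \<in> E \<Longrightarrow> b \<in> E \<Longrightarrow> contract a = contract b \<longleftrightarrow> cls a = cls b"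
  unfolding contract_def using inj_onD[OF inj_on_root_image] cls_reps by blast

lemma contract_cycles: "cycles (contract ` E) = (`) contract ` cycles E"
proof (intro equalityI subsetI)
  fix B assume B: "B \<in> cycles (contract ` E)"
  then obtain D where D: "D \<subseteq> reps" "B = (`) root ` D"
    unfolding contract_edges cycles_def by (auto simp: subset_image_iff)
  have "finite B" using B by (simp add: cycles_def)
  then have "finite D" using D inj_on_root_image by (metis finite_imageD inj_on_subset)
  then have "span D \<in> cycles E" using span_cycle_iff_contracted[OF _ D(1)] B unfolding contract_edges D(2) by simp
  then show "B \<in> (`) contract ` cycles E" using contract_span[OF D(1)] D(2) by blast
next
  fix B assume "B \<in> (`) contract ` cycles E"
  then obtain A where A: "A \<in> cycles E" "B = contract ` A" by blast
  obtain D where D: "finite D" "D \<subseteq> reps" "A = span D" using A(1) by (rule cycleE)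
  then show "B \<in> cycles (contract ` E)"
    using span_cycle_iff_contracted[OF D(1,2)] A contract_span[OF D(2)] unfolding contract_edges by simp
qed

lemma stretch_minimal_iff:
  assumes "C \<subseteq> E"
  shows "minimal_in (cycles (stretch ` E)) (stretch ` C) \<longleftrightarrow> minimal_in (cycles E) C"
proof (cases "C \<in> cycles E")
  case True
  show ?thesis
  proof (rule minimal_in_image[OF stretch_cycles _ _ True])
    show "stretch ` A \<subseteq> stretch ` B \<longleftrightarrow> A \<subseteq> B" if "A \<in> cycles E" "B \<in> cycles E" for A B
      using inj_on_image_mem_iff[OF inj_on_stretch] that unfolding cycles_def by blast
  qed simp
next
  case False
  have "stretch ` C \<notin> cycles (stretch ` E)"
  proof
    assume "stretch ` C \<in> cycles (stretch ` E)"
    then obtain A where A: "A \<in> cycles E" "stretch ` C = stretch ` A" unfolding stretch_cycles by blast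
    then have "C = A" using inj_on_image_eq_iff[OF inj_on_stretch assms] by (simp add: cycles_def)
    then show False using A False by simp
  qed
  then show ?thesis using False by (simp add: minimal_in_def)
qed

text \<open>Although \<open>contract\<close> identifies edges of a class, it preserves and reflects
  inclusion of cycles, because these are unions of classes.\<close>

lemma contract_minimal_iff:
  assumes "C \<in> cycles E"
  shows "minimal_in (cycles (contract ` E)) (contract ` C) \<longleftrightarrow> minimal_in (cycles E) C"
proof (rule minimal_in_image[OF contract_cycles _ _ assms])
  fix A B assume AB: "A \<in> cycles E" "B \<in> cycles E"
  have "A \<subseteq> B" if s: "contract ` A \<subseteq> contract ` B"
  proof
    fix a assume a: "a \<in> A"
    then obtain b where b: "b \<in> B" "contract a = contract b" using s by blast
    have "a \<in> E" "b \<in> E" using a b AB by (auto simp: cycles_def)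
    then show "a \<in> B" using saturated[OF AB(2) b(1)] contract_eq_iff b(2) by simp
  qed
  then show "contract ` A \<subseteq> contract ` B \<longleftrightarrow> A \<subseteq> B" by blast
qed simp

text \<open>The map \<open>h\<close> of the factorization, obtained by undoing the subdivision
  \<open>stretch\<close> and then contracting.\<close>

definition straighten :: "'v set \<Rightarrow> 'v set" where
  "straighten = contract \<circ> inv_into E stretch"

lemma straighten_stretch: "a \<in> E \<Longrightarrow> straighten (stretch a) = contract a"
  by (simp add: straighten_def inj_on_stretch)

lemma straighten_image: "A \<subseteq> E \<Longrightarrow> straighten ` (stretch ` A) = contract ` A"
  unfolding image_image by (rule image_cong) (auto simp: straighten_stretch)

lemma straighten_minimal:
  "{straighten ` C | C. minimal_in (cycles (stretch ` E)) C} = {D. minimal_in (cycles (contract ` E)) D}"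
proof (intro equalityI subsetI; clarsimp)
  fix C assume C: "minimal_in (cycles (stretch ` E)) C"
  then obtain A where A: "A \<in> cycles E" "C = stretch ` A"
    using minimal_inD(1)[OF C] unfolding stretch_cycles by blast
  have AE: "A \<subseteq> E" using A(1) by (simp add: cycles_def)
  then show "minimal_in (cycles (contract ` E)) (straighten ` C)"
    using C stretch_minimal_iff[OF AE] contract_minimal_iff[OF A(1)] straighten_image[OF AE] A(2) by simp
next
  fix D assume D: "minimal_in (cycles (contract ` E)) D"
  then obtain A where A: "A \<in> cycles E" "D = contract ` A"
    using minimal_inD(1)[OF D] unfolding contract_cycles by blast
  have AE: "A \<subseteq> E" using A(1) by (simp add: cycles_def)
  then show "\<exists>C. D = straighten ` C \<and> minimal_in (cycles (stretch ` E)) C"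
    using D stretch_minimal_iff[OF AE] contract_minimal_iff[OF A(1)] straighten_image[OF AE] A(2) by metis
qed

section \<open>Suspended chains and their replacement by edges\<close>

lemma chain_ends_chain:
  assumes "e \<in> reps" shows "chain_ends (chain e) = root ` e"
proof -
  have "deg (chain e) v = 1 \<longleftrightarrow> v \<in> root ` e" if "v \<in> root ` e \<union> tip ` twigs e" for v
    using that deg_chain(1,2)[OF assms] by force
  then show ?thesis unfolding chain_ends_def Union_chain[OF assms] by blast
qed

lemma chain_interior_chain:
  assumes "e \<in> reps" shows "chain_interior (chain e) = tip ` twigs e"
proof -
  have "root ` e \<inter> tip ` twigs e = {}" by (rule root_tip_disjoint)
  then show ?thesis unfolding chain_interior_def chain_ends_chain[OF assms] Union_chain[OF assms] by blast
qed

lemma suspended_chain_chain: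
  assumes e: "e \<in> reps" "twigs e \<noteq> {}" and E1: "edges G1 = stretch ` E"
  shows "suspended_chain G1 (chain e)"
proof -
  obtain x y where xy: "root ` e = {x, y}" "x \<noteq> y" and a: "arc x (root ` e \<union> tip ` twigs e) (chain e) y"
    by (rule chainE[OF e(1)])
  note U = Union_chain[OF e(1)]
  have fU: "finite (\<Union>(chain e))" unfolding U by (rule arc_basic(1)[OF a])
  obtain c where c: "c \<in> twigs e" using e(2) by blast
  have "tip c \<notin> root ` e" using tip_not_root c by (auto simp: twigs_def)
  then have "card (insert (tip c) (root ` e)) = 3" using card_root_image[OF e(1)] xy(1) by simp
  moreover have "insert (tip c) (root ` e) \<subseteq> \<Union>(chain e)" unfolding U using c by blast
  ultimately have c3: "card (\<Union>(chain e)) \<ge> 3" using card_mono[OF fU] by metis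
  have d1: "deg (chain e) x = 1" "deg (chain e) y = 1" using deg_chain(1)[OF e(1)] xy(1) by auto
  have d2: "deg (chain e) v = 2 \<and> deg (edges G1) v = 2" if "v \<in> \<Union>(chain e) - {x, y}" for v
  proof -
    have "v \<in> tip ` twigs e" using that unfolding U xy(1) by blast
    then obtain d where "d \<in> twigs e" "v = tip d" by blast
    then show ?thesis using deg_chain(2,3)[OF e(1)] E1 by simp
  qed
  have "x \<in> \<Union>(chain e)" "y \<in> \<Union>(chain e)" unfolding U xy(1) by blast+
  moreover have "chain e \<subseteq> edges G1" unfolding E1 by (auto simp: chain_def members_def)
  ultimately show ?thesis unfolding suspended_chain_def
    using fU c3 d1 d2 xy(2) arc_edge_connected[OF a] by blast
qed

text \<open>The family consists of the chains of classes with a twig, since a suspended chain has at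
  least three vertices. A class without twigs is a single edge, which \<open>stretch\<close> and
  \<open>straighten\<close> both represent by its root image.\<close>

lemma chain_contraction_straighten:
  assumes V: "V \<subseteq> range root"
  shows "chain_contraction (V \<union> tip ` forest, stretch ` E) (V, contract ` E) straighten"
    (is "chain_contraction ?G1 ?G2 _")
proof -
  let ?R = "{e \<in> reps. twigs e \<noteq> {}}"
  let ?Ps = "chain ` ?R"
  have eG: "edges ?G1 = stretch ` E" "edges ?G2 = contract ` E" "verts ?G1 = V \<union> tip ` forest" "verts ?G2 = V"
    by (simp_all add: edges_def verts_def)
  have U: "\<Union>?Ps = stretch ` (\<Union>e\<in>?R. members e)" by (auto simp: chain_def)
  have ends: "chain_ends ` ?Ps = (`) root ` ?R" using chain_ends_chain by (force simp: image_image)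
  have mE: "(\<Union>e\<in>?R. members e) \<subseteq> E" by (auto simp: members_def)
  let ?T = "{e \<in> reps. twigs e = {}}"
  \<comment> \<open>The edges outside all chains of the family are the one-element classes.\<close>
  have "E - (\<Union>e\<in>?R. members e) = ?T"
  proof (intro equalityI subsetI)
    fix a assume a: "a \<in> E - (\<Union>e\<in>?R. members e)"
    then have "twigs (cls a) = {}" using mem_members_cls[of a] cls_reps[of a] by blast
    then show "a \<in> ?T" using stretch_trivial(2)[of a] cls_reps[of a] a by auto
  next
    fix a assume "a \<in> ?T"
    then show "a \<in> E - (\<Union>e\<in>?R. members e)" by (auto simp: members_def reps_def)
  qed
  then have rest: "stretch ` E - \<Union>?Ps = stretch ` ?T"
    unfolding U using inj_on_image_set_diff[OF inj_on_stretch Diff_subset mE] by simp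
  have sT: "stretch e = root ` e" "straighten (stretch e) = root ` e" if "e \<in> ?T" for e
    using stretch_trivial(1)[of e] straighten_stretch[of e] repsD[of e] that by (auto simp: contract_def)
  have sT': "stretch ` ?T = (`) root ` ?T" using sT(1) by (rule image_cong[OF refl])
  have c1: "\<forall>P\<in>?Ps. suspended_chain ?G1 P" using suspended_chain_chain[OF _ _ eG(1)] by blast
  have c2: "\<forall>P\<in>?Ps. \<forall>Q\<in>?Ps. P \<noteq> Q \<longrightarrow> P \<inter> Q = {}"
  proof (intro ballI impI)
    fix P Q assume "P \<in> ?Ps" "Q \<in> ?Ps" "P \<noteq> Q"
    then obtain e g where "P = chain e" "Q = chain g" "e \<noteq> g" by blast
    moreover from this(3) have "members e \<inter> members g = {}" by (auto simp: members_def)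
    moreover have "members e \<subseteq> E" "members g \<subseteq> E" by (auto simp: members_def)
    ultimately show "P \<inter> Q = {}"
      unfolding chain_def using inj_on_image_Int[OF inj_on_stretch, of "members e" "members g"] by simp
  qed
  have c3: "inj_on chain_ends ?Ps"
  proof (rule inj_onI)
    fix P Q assume PQ: "P \<in> ?Ps" "Q \<in> ?Ps" "chain_ends P = chain_ends Q"
    obtain e g where eg: "P = chain e" "Q = chain g" "e \<in> reps" "g \<in> reps" using PQ(1,2) by blast
    then have "root ` e = root ` g" using PQ(3) chain_ends_chain by simp
    then show "P = Q" using inj_onD[OF inj_on_root_image _ eg(3,4)] eg(1,2) by simp
  qed
  have "?R \<inter> ?T = {}" "?R \<subseteq> reps" "?T \<subseteq> reps" by auto
  then have "(`) root ` ?R \<inter> (`) root ` ?T = {}"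
    using inj_on_image_Int[OF inj_on_root_image, of ?R ?T] by simp
  then have c4: "chain_ends ` ?Ps \<inter> (edges ?G1 - \<Union>?Ps) = {}" unfolding eG ends rest sT' .
  have "(\<Union>P\<in>?Ps. chain_interior P) = (\<Union>e\<in>?R. tip ` twigs e)" using chain_interior_chain by simp
  also have "\<dots> = tip ` forest"
  proof (intro equalityI subsetI)
    fix v assume "v \<in> tip ` forest"
    then obtain c where c: "c \<in> forest" "v = tip c" by blast
    then have "c \<in> twigs (cls c)" "cls c \<in> reps" using cls_reps forest_subset by (auto simp: twigs_def)
    then show "v \<in> (\<Union>e\<in>?R. tip ` twigs e)" using c(2) by blast
  qed (auto simp: twigs_def)
  finally have int: "(\<Union>P\<in>?Ps. chain_interior P) = tip ` forest" .
  \<comment> \<open>Roots are not tips, so deleting the chain interiors leaves exactly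
    \<open>V\<close>.\<close>
  have "V \<inter> tip ` forest = {}" using V tip_not_root by blast
  then have c5: "verts ?G2 = verts ?G1 - (\<Union>P\<in>?Ps. chain_interior P)" unfolding eG int by blast
  have reps: "?T \<union> ?R = reps" by auto
  have c6: "edges ?G2 = (edges ?G1 - \<Union>?Ps) \<union> chain_ends ` ?Ps"
    unfolding eG ends rest sT' contract_edges image_Un[symmetric] reps
    by (simp add: edges_def)
  have c7: "\<forall>P\<in>?Ps. \<forall>g\<in>P. straighten g = chain_ends P"
  proof (intro ballI)
    fix P g assume "P \<in> ?Ps" "g \<in> P"
    then obtain e a where ea: "e \<in> reps" "P = chain e" "a \<in> members e" "g = stretch a" by (auto simp: chain_def)
    then show "straighten g = chain_ends P"
      using straighten_stretch[of a] chain_ends_chain[of e] by (simp add: members_def contract_def)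
  qed
  have c8: "\<forall>g\<in>edges ?G1 - \<Union>?Ps. straighten g = g"
  proof
    fix g assume "g \<in> edges ?G1 - \<Union>?Ps"
    then obtain e where "e \<in> ?T" "g = stretch e" unfolding eG rest by blast
    then show "straighten g = g" using sT[of e] by (simp only:)
  qed
  show ?thesis unfolding chain_contraction_def
    by (rule exI[of _ ?Ps],
        rule conjI[OF c1 conjI[OF c2 conjI[OF c3 conjI[OF c4 conjI[OF c5 conjI[OF c6 conjI[OF c7 c8]]]]]]])
qed

end

section \<open>Circuit surjections\<close>

text \<open>An edge of the circuit has another circuit edge at each of its ends; a common one would
  contain both ends and so be the same edge.\<close>

lemma circuit_card_ge_3:
  assumes "wf_graph H" "circuit H D" shows "3 \<le> card D"
proof -
  have D: "D \<subseteq> edges H" "finite D" "D \<noteq> {}" "\<And>v. v \<in> \<Union>D \<Longrightarrow> deg D v = 2"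
    using assms(2) by (auto simp: circuit_def)
  obtain e where e: "e \<in> D" using D(3) by blast
  then have "card e = 2" using assms(1) D(1) by (auto simp: wf_graph_iff)
  then obtain u v where uv: "e = {u, v}" "u \<noteq> v" by (auto simp: card_2_iff)
  have other: "\<exists>g\<in>D. g \<noteq> e \<and> w \<in> g" if w: "w \<in> e" for w
  proof (rule ccontr)
    assume "\<not> ?thesis"
    then have "{g \<in> D. w \<in> g} \<subseteq> {e}" by blast
    then have "card {g \<in> D. w \<in> g} \<le> card {e}" by (rule card_mono[rotated]) simp
    then show False using D(4)[of w] w e unfolding deg_def by auto
  qed
  have "u \<in> e" "v \<in> e" using uv(1) by simp_all
  then obtain g h where gh: "g \<in> D" "g \<noteq> e" "u \<in> g" "h \<in> D" "h \<noteq> e" "v \<in> h" using other by meson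
  have "g \<noteq> h"
  proof
    assume "g = h"
    then have s: "e \<subseteq> g" using gh uv(1) by simp
    have c: "card g = 2" using assms(1) D(1) gh(1) by (auto simp: wf_graph_iff)
    then have "finite g" by (intro card_ge_0_finite) simp
    then have "e = g" using s c \<open>card e = 2\<close> by (simp add: card_subset_eq)
    then show False using gh(2) by simp
  qed
  then have "card {e, g, h} = 3" using gh by simp
  moreover have "card {e, g, h} \<le> card D" by (rule card_mono[OF D(2)]) (use e gh in simp)
  ultimately show ?thesis by simp
qed

text \<open>By \<open>minimal_surjection_series\<close>, a circuit that splits a fibre would make
  \<open>H\<close> a circuit. So fibres behave as series classes, and circuits of \<open>H\<close>
  having at least three edges yields the last axiom.\<close>

lemma series_partition_of_circuit_surj:
  assumes G: "wf_graph G" "two_connected G" and H: "wf_graph H" "\<not> circuit H (edges H)"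
    and f: "circuit_surj G H f"
    and cls: "\<And>a. a \<in> edges G \<Longrightarrow> cls a \<in> edges G \<and> f (cls a) = f a"
      "\<And>a b. a \<in> edges G \<Longrightarrow> b \<in> edges G \<Longrightarrow> cls a = cls b \<longleftrightarrow> f a = f b"
  shows "series_partition (edges G) cls"
proof -
  let ?Z = "cycles (edges G)"
  interpret cycle_space ?Z by (rule cycle_space_cycles)
  have img: "minimal_in (cycles (edges H)) (f ` C)" if "minimal_in ?Z C" for C
    using that f circuit_iff_minimal[OF G(1)] circuit_iff_minimal[OF H(1)] by (simp add: circuit_surj_def)
  note conn = two_connected_common_circuit[OF G]
  have series: "g \<in> C" if C: "minimal_in ?Z C" "e \<in> C" "g \<in> edges G" "f g = f e" for C e g
  proof (rule ccontr)
    assume "g \<notin> C"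
    have CE: "C \<subseteq> edges G" using minimal_inD(1)[OF C(1)] by (simp add: cycles_def)
    have "f ` edges G = f ` C"
    proof (rule minimal_surjection_series[OF cycle_space_cycles cycle_space_cycles])
      show "minimal_in (cycles (edges H)) (f ` D)" if "minimal_in ?Z D" for D by (rule img[OF that])
      show "\<exists>D. minimal_in ?Z D \<and> a \<in> D \<and> b \<in> D" if "a \<in> edges G" "b \<in> edges G" "a \<noteq> b" for a b
        by (rule conn[OF that])
    qed (fact C(1) CE C(2,3) \<open>g \<notin> C\<close> C(4)[symmetric])+
    then have "edges H = f ` C" using f by (simp add: circuit_surj_def)
    then have "circuit H (edges H)" using img[OF C(1)] circuit_iff_minimal[OF H(1)] by simp
    then show False using H(2) by blast
  qed
  show ?thesis
  proof
    fix e assume e: "e \<in> edges G"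
    show "card e = 2" using G(1) e by (simp add: wf_graph_iff)
    show "cls e \<in> edges G" using cls(1)[OF e] by simp
    show "cls (cls e) = cls e" using cls(1)[OF e] cls(2)[of "cls e" e] e by simp
    \<comment> \<open>A circuit through two members of a fibre contains the whole fibre.
      \<open>conn\<close> needs two different edges, so smaller fibres are treated apart.\<close>
    show "finite {g \<in> edges G. cls g = e}"
    proof (cases "\<exists>a b. a \<in> edges G \<and> cls a = e \<and> b \<in> edges G \<and> cls b = e \<and> a \<noteq> b")
      case True
      then obtain a b where ab: "a \<in> edges G" "cls a = e" "b \<in> edges G" "cls b = e" "a \<noteq> b" by blast
      obtain C where C: "minimal_in ?Z C" "a \<in> C" "b \<in> C" using conn[OF ab(1,3,5)] by blast
      have "{g \<in> edges G. cls g = e} \<subseteq> C"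
      proof clarify
        fix g assume "g \<in> edges G" "e = cls g"
        then show "g \<in> C" using series[OF C(1,2)] cls(2)[of g a] ab(1,2) by simp
      qed
      then show ?thesis by (rule finite_subset) (rule finite_mem[OF minimal_inD(1)[OF C(1)]])
    next
      case False
      show ?thesis
      proof (cases "\<exists>a. a \<in> edges G \<and> cls a = e")
        case True
        then obtain a where "a \<in> edges G" "cls a = e" by blast
        then have "{g \<in> edges G. cls g = e} \<subseteq> {a}" using False by blast
        then show ?thesis by (rule finite_subset) simp
      next
        case False
        then have "{g \<in> edges G. cls g = e} = {}" by blast
        then show ?thesis by (simp only: finite.emptyI)
      qed
    qed
  next
    fix A e g assume A: "A \<in> ?Z" "e \<in> A" "g \<in> edges G" "cls g = cls e"
    have "e \<in> edges G" using A(1,2) by (auto simp: cycles_def)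
    then have "f g = f e" using cls(2) A(3,4) by blast
    moreover obtain C where "minimal_in ?Z C" "e \<in> C" "C \<subseteq> A" using A(1,2) by (rule minimal_through)
    ultimately show "g \<in> A" using series A(3) by blast
  next
    fix A assume A: "A \<in> ?Z" "A \<noteq> {}"
    then obtain e where "e \<in> A" by blast
    with A(1) obtain C where C: "minimal_in ?Z C" "C \<subseteq> A" by (rule minimal_through)
    have AE: "A \<subseteq> edges G" "finite A" using A(1) by (auto simp: cycles_def)
    have "3 \<le> card (f ` C)"
      using circuit_card_ge_3[OF H(1)] img[OF C(1)] circuit_iff_minimal[OF H(1)] by blast
    also have "f ` C = f ` (cls ` C)"
      unfolding image_image using cls(1) AE(1) C(2) by (intro image_cong) auto
    also have "card \<dots> \<le> card (cls ` C)"
      using finite_subset[OF C(2) AE(2)] by (intro card_image_le) simp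
    also have "\<dots> \<le> card (cls ` A)" using C(2) AE(2) by (intro card_mono) auto
    finally show "3 \<le> card (cls ` A)" .
  qed
qed

theorem theorem1p1:
  fixes G :: "'a graph" and H :: "'b graph" and f :: "'a set \<Rightarrow> 'b set"
  assumes "wf_graph G" and "two_connected G"
    and "wf_graph H" and "\<not> circuit H (edges H)"
    and "circuit_surj G H f"
  shows "\<exists>(G1 :: 'a graph) (G2 :: 'a graph) k h q.
     wf_graph G1 \<and> wf_graph G2 \<and>
     (\<forall>e\<in>edges G. f e = q (h (k e))) \<and>
     bij_betw k (edges G) (edges G1) \<and>
     (\<forall>C. C \<subseteq> edges G \<longrightarrow> (circuit G C \<longleftrightarrow> circuit G1 (k ` C))) \<and>
     h ` edges G1 = edges G2 \<and>
     chain_contraction G1 G2 h \<and>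
     {h ` C | C. circuit G1 C} = {D. circuit G2 D} \<and>
     circuit_inj G2 H q"
proof -
  \<comment> \<open>The choice depends only on \<open>f a\<close>, so it picks one representative
    for each fibre.\<close>
  define cls where "cls = (\<lambda>a. SOME g. g \<in> edges G \<and> f g = f a)"
  have cls1: "cls a \<in> edges G \<and> f (cls a) = f a" if "a \<in> edges G" for a
    unfolding cls_def by (rule someI[of _ a]) (use that in simp)
  have cls2: "cls a = cls b \<longleftrightarrow> f a = f b" if "a \<in> edges G" "b \<in> edges G" for a b
  proof
    show "f a = f b" if "cls a = cls b"
      using cls1[OF \<open>a \<in> edges G\<close>] cls1[OF \<open>b \<in> edges G\<close>] that by metis
  qed (simp add: cls_def)
  interpret series_partition "edges G" cls
    by (rule series_partition_of_circuit_surj[OF assms cls1 cls2])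
  \<comment> \<open>One vertex for each tree of the forest; \<open>G1\<close> adds the tips as
    subdividing vertices.\<close>
  let ?V = "root ` verts G"
  define G1 where "G1 = (?V \<union> tip ` forest, stretch ` edges G)"
  define G2 where "G2 = (?V, contract ` edges G)"
  have e12: "edges G1 = stretch ` edges G" "edges G2 = contract ` edges G"
    and v12: "verts G1 = ?V \<union> tip ` forest" "verts G2 = ?V"
    by (simp_all add: G1_def G2_def edges_def verts_def)
  have V: "root ` cls a \<subseteq> ?V" if "a \<in> edges G" for a
    using cls_mem[OF that] assms(1) by (auto simp: wf_graph_iff)
  have wf1: "wf_graph G1" unfolding wf_graph_iff e12 v12
  proof (intro ballI)
    fix g assume "g \<in> stretch ` edges G"
    then obtain a where a: "a \<in> edges G" "g = stretch a" by blast
    have "tip ` twigs (cls a) \<subseteq> tip ` forest" by (auto simp: twigs_def)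
    then have "stretch a \<subseteq> ?V \<union> tip ` forest"
      by (intro order_trans[OF stretch_edge(1)[OF a(1)]] Un_mono V[OF a(1)])
    then show "card g = 2 \<and> g \<subseteq> ?V \<union> tip ` forest" using stretch_edge(2)[OF a(1)] a(2) by simp
  qed
  have wf2: "wf_graph G2" unfolding wf_graph_iff e12 v12
    using V card_root_image cls_reps by (auto simp: contract_def)
  note circ = circuit_iff_minimal[OF assms(1)] circuit_iff_minimal[OF wf1, unfolded e12]
    circuit_iff_minimal[OF wf2, unfolded e12]
  \<comment> \<open>The fibres of \<open>contract\<close> are exactly those of \<open>f\<close>, so
    any edge over \<open>d\<close> gives the same value, and \<open>q\<close> is injective.\<close>
  define q where "q = (\<lambda>d. f (SOME a. a \<in> edges G \<and> contract a = d))"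
  have q: "q (contract a) = f a" if a: "a \<in> edges G" for a
  proof -
    define b where "b = (SOME b. b \<in> edges G \<and> contract b = contract a)"
    have "b \<in> edges G \<and> contract b = contract a" unfolding b_def by (rule someI[of _ a]) (use a in simp)
    then have "f b = f a" using contract_eq_iff[of b a] cls2[of b a] a by simp
    then show ?thesis by (simp add: q_def b_def)
  qed
  have qim: "q ` (contract ` A) = f ` A" if "A \<subseteq> edges G" for A
    unfolding image_image using q that by (intro image_cong) auto
  have "circuit H (q ` D)" if "circuit G2 D" for D
  proof -
    have "D \<in> cycles (contract ` edges G)" using that unfolding circ by (rule minimal_inD(1))
    then obtain A where A: "A \<in> cycles (edges G)" "D = contract ` A" unfolding contract_cycles by blast
    then have "circuit G A" using that contract_minimal_iff[OF A(1)] unfolding circ by simp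
    then show ?thesis using assms(5) qim[of A] A by (simp add: circuit_surj_def circuit_def)
  qed
  moreover have "inj_on q (edges G2)" unfolding e12
  proof (intro inj_onI; elim imageE)
    fix d d' a b assume "q d = q d'" "d = contract a" "a \<in> edges G" "d' = contract b" "b \<in> edges G"
    then show "d = d'" using q cls2[of a b] contract_eq_iff[of a b] by simp
  qed
  ultimately have q_inj: "circuit_inj G2 H q"
    using assms(5) qim[of "edges G"] by (simp add: circuit_inj_def circuit_surj_def e12)
  have "?V \<subseteq> range root" by blast
  from chain_contraction_straighten[OF this] have cc: "chain_contraction G1 G2 straighten"
    by (simp add: G1_def G2_def)
  have bij: "bij_betw stretch (edges G) (edges G1)"
    unfolding e12 using inj_on_stretch by (rule inj_on_imp_bij_betw)
  show ?thesis
  proof (rule exI[of _ G1], rule exI[of _ G2], rule exI[of _ stretch], rule exI[of _ straighten],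
      rule exI[of _ q], intro conjI)
    show "wf_graph G1" "wf_graph G2" by (fact wf1, fact wf2)
    show "\<forall>e\<in>edges G. f e = q (straighten (stretch e))" using straighten_stretch q by simp
    show "bij_betw stretch (edges G) (edges G1)" by (fact bij)
    show "\<forall>C. C \<subseteq> edges G \<longrightarrow> (circuit G C \<longleftrightarrow> circuit G1 (stretch ` C))"
      unfolding circ using stretch_minimal_iff by blast
    show "straighten ` edges G1 = edges G2" unfolding e12 by (rule straighten_image) simp
    show "chain_contraction G1 G2 straighten" by (fact cc)
    show "{straighten ` C | C. circuit G1 C} = {D. circuit G2 D}"
      unfolding circ by (rule straighten_minimal)
    show "circuit_inj G2 H q" by (fact q_inj)
  qed
qed

end
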